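(* For each integer $r\ge 1$ let $\mathcal{WH}(r)=(\mathrm{WH}_n(r))_n$ be the family of $r$-wheels, and let $p_c^+(\mathcal{WH}(r))$ be its critical probability for strict majority bootstrap percolation. Then the limit $\lim_{r\to\infty} p_c^+(\mathcal{WH}(r))$ exists and equals $1/4$.
   Context: Strict majority bootstrap percolation (strict MBP) on a finite simple graph $G=(V,E)$: each vertex is initially active or passive; at each step every passive vertex $v$ having at least $\lceil (\deg(v)+1)/2\rceil$ active neighbors becomes active; active vertices stay active forever. The initial set $A\subseteq V$ of active vertices percolates $G$ if all vertices of $G$ are eventually active. $\mathbb{P}_p$ denotes probability when each vertex of $G$ belongs to $A$ independently with probability $p$. $R_n(r)$ is the graph on vertices $0,1,\dots,n-1$ (indices modulo $n$) in which every vertex is adjacent to its $r$ closest vertices to the left and its $r$ closest vertices to the right, i.e. distinct $i,j$ are adjacent iff $j\equiv i+k \pmod n$ for some $k$ with $1\le |k|\le r$. The $r$-wheel $\mathrm{WH}_n(r)=u*R_n(r)$ is $R_n(r)$ together with one additional vertex $u$ adjacent to all vertices of $R_n(r)$. For a family of graphs $\mathcal{G}=(G_n)_n$, $$p_c^+(\mathcal{G})=\inf\Big\{p\in[0,1] : \liminf_{n\to\infty}\mathbb{P}_p(A \text{ percolates } G_n \text{ in strict MBP})=1\Big\}.$$ *)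

theory Defs
  imports "HOL-Probability.Probability" "HOL-Number_Theory.Cong"
begin

record 'a graph =
  verts :: "'a set"
  edges :: "'a set set"

definition finite_simple_graph :: "'a graph \<Rightarrow> bool" where
  "finite_simple_graph G \<longleftrightarrow>
     finite (verts G) \<and> (\<forall>e\<in>edges G. e \<subseteq> verts G \<and> card e = 2)"

definition nbrs :: "'a graph \<Rightarrow> 'a \<Rightarrow> 'a set" where
  "nbrs G v = {w. {v, w} \<in> edges G}"

definition deg :: "'a graph \<Rightarrow> 'a \<Rightarrow> nat" where
  "deg G v = card (nbrs G v)"

definition mbp_step :: "'a graph \<Rightarrow> 'a set \<Rightarrow> 'a set" where
  "mbp_step G S =
     S \<union> {v \<in> verts G - S. int (card (nbrs G v \<inter> S)) \<ge> \<lceil>(real (deg G v) + 1) / 2\<rceil>}"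

definition percolates :: "'a graph \<Rightarrow> 'a set \<Rightarrow> bool" where
  "percolates G A \<longleftrightarrow> (\<forall>v\<in>verts G. \<exists>t. v \<in> (mbp_step G ^^ t) A)"

(* Pi_pmf makes the values f v, for v in the finite set verts G, independent Bernoulli(p)
   variables (and f v = False for all other v); the random initial set is the set of v with f v. *)
definition percolation_prob :: "'a graph \<Rightarrow> real \<Rightarrow> real" where
  "percolation_prob G p =
     measure_pmf.prob (Pi_pmf (verts G) False (\<lambda>_. bernoulli_pmf p))
       {f. percolates G {v \<in> verts G. f v}}"

definition critical_prob :: "(nat \<Rightarrow> 'a graph) \<Rightarrow> real" where
  "critical_prob \<G> =
     Inf {p \<in> {0..1}. liminf (\<lambda>n. ereal (percolation_prob (\<G> n) p)) = 1}"

definition ring_graph :: "nat \<Rightarrow> nat \<Rightarrow> nat graph" where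
  "ring_graph r n =
     \<lparr>verts = {..<n},
      edges = {{i, j} | i j. i < n \<and> j < n \<and> i \<noteq> j \<and>
        (\<exists>k::int. 1 \<le> \<bar>k\<bar> \<and> \<bar>k\<bar> \<le> int r \<and> [int j = int i + k] (mod int n))}\<rparr>"

(* The join u * G of G with one new vertex u; here u is None. *)
definition cone :: "'a graph \<Rightarrow> 'a option graph" where
  "cone G =
     \<lparr>verts = insert None (Some ` verts G),
      edges = (\<lambda>e. Some ` e) ` edges G \<union> {{None, Some v} | v. v \<in> verts G}\<rparr>"

definition wheel :: "nat \<Rightarrow> nat \<Rightarrow> nat option graph" where
  "wheel r n = cone (ring_graph r n)"

lemma finite_simple_graph_ring_graph: "finite_simple_graph (ring_graph r n)"
  by (auto simp: finite_simple_graph_def ring_graph_def)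

lemma finite_simple_graph_cone:
  "finite_simple_graph G \<Longrightarrow> finite_simple_graph (cone G)"
  by (auto simp: finite_simple_graph_def cone_def card_image)

lemma finite_simple_graph_wheel: "finite_simple_graph (wheel r n)"
  by (simp add: wheel_def finite_simple_graph_cone finite_simple_graph_ring_graph)

end

theory Submission
  imports Defs
begin

text \<open>
  While the hub is passive, a ring vertex needs \<open>r + 1\<close> of its \<open>2 r\<close> ring neighbours to be active.
  Somewhere a growing interval must be born, which costs probability about
  \<open>binom(2r, r) p^r (1-p)^r \<approx> (4 p (1-p))^r\<close> per site, and a growing interval is stopped only by a run of
  \<open>r + 1\<close> passive vertices, which has probability about \<open>(1-p)^r\<close> per site. These two rates
  balance exactly at \<open>4 p = 1\<close>.

  If \<open>p < 1/4\<close>, a typical vertex sits between two blocking runs with no vertex in between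
  that sees a majority; so fewer than half of the ring vertices ever become active and the hub,
  if initially passive, stays passive. If \<open>p > 1/4\<close>, intervals are born much more often than
  blocking runs occur, so almost all of the ring becomes active; then the hub does, which lowers
  the threshold on the ring to \<open>r\<close>, and everything is activated.
\<close>

subsection \<open>The final active set\<close>

text \<open>The hub sees the whole ring and couples everything, so in both directions it enters only
  through the question whether half of the ring is active. Since \<open>r\<close> is fixed while
  \<open>n\<close> grows, all auxiliary lengths depend on \<open>r\<close> and \<open>p\<close> but
  not on \<open>n\<close>. Below 1/4 a bound on an expectation is enough, because the percolation
  probability only has to stay below a constant smaller than 1. Above 1/4 there are two obstacles:
  windows of length \<open>2 r\<close> overlap and are dependent, and a bare majority at one place
  need not keep growing. Cells of a fixed length \<open>2 k\<close> with at least
  \<open>k + 1\<close> active vertices answer both. Disjoint cells are independent, their density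
  exceeds 1/2 by an amount that does not shrink with \<open>r\<close>, and for suitable
  \<open>k\<close> such a cell is at least twice as likely as a run of \<open>k\<close> passive
  vertices.\<close>

definition final_active :: "'a graph \<Rightarrow> 'a set \<Rightarrow> 'a set" where
  "final_active G A = (\<Union>t. (mbp_step G ^^ t) A)"

lemma percolates_iff: "percolates G A \<longleftrightarrow> verts G \<subseteq> final_active G A"
  by (auto simp: percolates_def final_active_def)

lemma finite_nbrs:
  assumes "finite_simple_graph G"
  shows "finite (nbrs G v)"
proof (rule finite_subset)
  show "nbrs G v \<subseteq> verts G"
    using assms by (auto simp: nbrs_def finite_simple_graph_def)
  show "finite (verts G)"
    using assms by (simp add: finite_simple_graph_def)
qed

lemma mbp_step_mono:
  assumes "finite_simple_graph G" "S \<subseteq> T"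
  shows "mbp_step G S \<subseteq> mbp_step G T"
proof -
  have "int (card (nbrs G v \<inter> S)) \<le> int (card (nbrs G v \<inter> T))" for v
    using assms finite_nbrs[OF assms(1)] by (intro of_nat_mono card_mono) auto
  from order_trans[OF _ this] show ?thesis
    using assms(2) unfolding mbp_step_def by blast
qed

lemma subset_final_active: "A \<subseteq> final_active G A"
proof -
  have "(mbp_step G ^^ 0) A \<subseteq> final_active G A"
    unfolding final_active_def by blast
  then show ?thesis by simp
qed

text \<open>The active neighbours may appear at different times. There are finitely many, so a
  single time \<open>t\<close> contains them all, and \<open>v\<close> joins at time
  \<open>t + 1\<close>.\<close>

lemma final_activeI:
  assumes "finite_simple_graph G" "v \<in> verts G"
    and "\<lceil>(real (deg G v) + 1) / 2\<rceil> \<le> int (card (nbrs G v \<inter> final_active G A))"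
  shows "v \<in> final_active G A"
proof -
  let ?S = "\<lambda>t. (mbp_step G ^^ t) A"
  have inc: "?S s \<subseteq> ?S t" if "s \<le> t" for s t
    using that by (induction rule: dec_induct) (auto simp: mbp_step_def)
  have "finite N \<Longrightarrow> N \<subseteq> final_active G A \<Longrightarrow> \<exists>t. N \<subseteq> ?S t" for N
  proof (induction N rule: finite_induct)
    case (insert x N)
    then obtain s t where "N \<subseteq> ?S s" "x \<in> ?S t"
      by (auto simp: final_active_def)
    then have "insert x N \<subseteq> ?S (max s t)"
      using inc[of s "max s t"] inc[of t "max s t"] by auto
    then show ?case by blast
  qed simp
  from this[of "nbrs G v \<inter> final_active G A"]
  obtain t where t: "nbrs G v \<inter> final_active G A \<subseteq> ?S t"
    using finite_nbrs[OF assms(1)] by auto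
  have "card (nbrs G v \<inter> final_active G A) \<le> card (nbrs G v \<inter> ?S t)"
    using t finite_nbrs[OF assms(1)] by (intro card_mono) auto
  then have "v \<in> ?S (Suc t)"
    using assms(2,3) by (auto simp: mbp_step_def)
  then show ?thesis
    unfolding final_active_def by blast
qed

lemma final_active_subset:
  assumes "finite_simple_graph G" "A \<subseteq> S" "mbp_step G S \<subseteq> S"
  shows "final_active G A \<subseteq> S"
proof -
  have "(mbp_step G ^^ t) A \<subseteq> S" for t
  proof (induction t)
    case (Suc t)
    have "mbp_step G ((mbp_step G ^^ t) A) \<subseteq> S"
      by (rule order_trans[OF mbp_step_mono[OF assms(1) Suc] assms(3)])
    then show ?case by simp
  qed (use assms in simp)
  then show ?thesis
    unfolding final_active_def by blast
qed

subsection \<open>Neighbourhoods in the wheel\<close>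

text \<open>
  Ring vertices are addressed by integers modulo \<open>n\<close>, so that intervals need no wrap-around.
\<close>

definition pos :: "nat \<Rightarrow> int \<Rightarrow> nat option" where
  "pos n z = Some (nat (z mod int n))"

definition nhd :: "nat \<Rightarrow> int \<Rightarrow> int set" where
  "nhd r z = {z - int r..z + int r} - {z}"

lemma finite_nhd [simp]: "finite (nhd r z)"
  by (simp add: nhd_def)

lemma card_nhd [simp]: "card (nhd r z) = 2 * r"
  by (simp add: nhd_def)

lemma pos_eq_iff: "n > 0 \<Longrightarrow> pos n y = pos n z \<longleftrightarrow> y mod int n = z mod int n"
  by (simp add: pos_def eq_nat_nat_iff)

lemma pos_eqE:
  assumes "n > 0" "pos n y = pos n z"
  obtains k where "y = z + k * int n"
proof -
  have "int n dvd y - z"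
    using assms by (simp add: pos_eq_iff mod_eq_dvd_iff)
  then obtain k where "y - z = int n * k" ..
  then have "y = z + k * int n" by (simp add: algebra_simps)
  then show thesis by (rule that)
qed

lemma pos_add_mult [simp]: "pos n (z + k * int n) = pos n z"
  by (simp add: pos_def)

lemma pos_of_nat: "i < n \<Longrightarrow> pos n (int i) = Some i"
  by (simp add: pos_def)

lemma pos_in_verts: "n > 0 \<Longrightarrow> pos n z \<in> Some ` {..<n}"
  by (auto simp: pos_def nat_less_iff)

lemma inj_on_pos: "inj_on (pos n) {a..<a + int n}"
proof (cases "n = 0")
  case False
  show ?thesis
  proof (rule inj_onI)
    fix x y assume x: "x \<in> {a..<a + int n}" and y: "y \<in> {a..<a + int n}" and "pos n x = pos n y"
    then obtain k where k: "x = y + k * int n"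
      using False pos_eqE[of n x y] by blast
    have "k * int n < 1 * int n" "(-1) * int n < k * int n"
      using k x y unfolding atLeastLessThan_iff by linarith+
    then have "k = 0"
      unfolding mult_less_cancel_right by simp
    with k show "x = y" by simp
  qed
qed simp

lemma verts_wheel: "verts (wheel r n) = insert None (Some ` {..<n})"
  by (simp add: wheel_def cone_def ring_graph_def)

lemma nbrs_wheel_None: "nbrs (wheel r n) None = Some ` {..<n}"
  by (auto simp: nbrs_def wheel_def cone_def ring_graph_def doubleton_eq_iff)

lemma edges_wheel_Some:
  "{Some i, Some j} \<in> edges (wheel r n) \<longleftrightarrow> {i, j} \<in> edges (ring_graph r n)"
proof -
  have "inj (\<lambda>e. (Some :: nat \<Rightarrow> nat option) ` e)"
    by (simp add: inj_image_eq_iff inj_def)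
  moreover have "{Some i, Some j} = Some ` {i, j}" by simp
  ultimately show ?thesis
    unfolding wheel_def cone_def
    by (auto simp: doubleton_eq_iff inj_image_mem_iff simp del: image_insert)
qed

lemma edges_ring_graph:
  "{i, j} \<in> edges (ring_graph r n) \<longleftrightarrow> i < n \<and> j < n \<and> i \<noteq> j \<and>
    (\<exists>k::int. 1 \<le> \<bar>k\<bar> \<and> \<bar>k\<bar> \<le> int r \<and> [int j = int i + k] (mod int n))" (is "?L \<longleftrightarrow> ?R i j")
proof
  \<comment> \<open>An edge is an unordered pair, so its two ends may come in either order; swapping
    them replaces the offset \<open>k\<close> by \<open>- k\<close>.\<close>
  have sym: "?R j i" if ij: "?R i j" for i j
  proof -
    obtain k :: int where k: "1 \<le> \<bar>k\<bar>" "\<bar>k\<bar> \<le> int r" "[int j = int i + k] (mod int n)"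
      using ij by blast
    from k(3) have "[int i = int j + (- k)] (mod int n)"
      by (simp add: cong_iff_dvd_diff algebra_simps dvd_diff_commute)
    with k(1,2) ij show ?thesis by (intro conjI exI[of _ "- k"]) auto
  qed
  assume ?L
  then obtain i' j' where *: "{i, j} = {i', j'}" "?R i' j'"
    unfolding ring_graph_def by auto
  show "?R i j"
    using * sym[of i' j'] by (auto simp: doubleton_eq_iff)
qed (unfold ring_graph_def, simp, blast)

text \<open>The condition \<open>2 * r < n\<close> makes the \<open>2 r + 1\<close> integers around
  \<open>z\<close> pairwise incongruent, so no neighbour coincides with \<open>z\<close> and none is
  counted twice.\<close>

lemma nbrs_wheel_pos:
  assumes "2 * r < n"
  shows "nbrs (wheel r n) (pos n z) = insert None (pos n ` nhd r z)"
proof -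
  have n: "n > 0" using assms by simp
  have None: "None \<in> nbrs (wheel r n) (pos n z)"
    using pos_in_verts[OF n, of z]
    by (auto simp: nbrs_def wheel_def cone_def ring_graph_def doubleton_eq_iff)
  have Some: "Some j \<in> nbrs (wheel r n) (pos n z) \<longleftrightarrow> Some j \<in> pos n ` nhd r z" for j
  proof
    assume "Some j \<in> nbrs (wheel r n) (pos n z)"
    then have "{nat (z mod int n), j} \<in> edges (ring_graph r n)"
      by (simp add: nbrs_def pos_def edges_wheel_Some)
    then obtain k where j: "j < n" and k: "1 \<le> \<bar>k\<bar>" "\<bar>k\<bar> \<le> int r"
      "[int j = int (nat (z mod int n)) + k] (mod int n)"
      unfolding edges_ring_graph by blast
    then have "int j mod int n = (z + k) mod int n"
      using n by (simp add: cong_def mod_simps)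
    then have "Some j = pos n (z + k)"
      using n pos_eq_iff[of n "int j" "z + k"] pos_of_nat[OF j] by simp
    moreover have "z + k \<in> nhd r z"
      using k by (auto simp: nhd_def)
    ultimately show "Some j \<in> pos n ` nhd r z" by blast
  next
    assume "Some j \<in> pos n ` nhd r z"
    then obtain y where y: "y \<in> nhd r z" "Some j = pos n y" by auto
    have j: "j < n" using pos_in_verts[OF n, of y] y by auto
    have "y \<noteq> z" "y \<in> {z - int r..<z - int r + int n}" "z \<in> {z - int r..<z - int r + int n}"
      using y(1) assms by (auto simp: nhd_def)
    then have "pos n y \<noteq> pos n z"
      using inj_on_pos[of n "z - int r"] by (auto dest: inj_onD)
    then have "j \<noteq> nat (z mod int n)" using y(2) by (simp add: pos_def)
    moreover have "[int j = int (nat (z mod int n)) + (y - z)] (mod int n)"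
      using y(2) n by (simp add: pos_def cong_def mod_simps)
    moreover have "1 \<le> \<bar>y - z\<bar>" "\<bar>y - z\<bar> \<le> int r"
      using y(1) by (auto simp: nhd_def)
    ultimately have "{nat (z mod int n), j} \<in> edges (ring_graph r n)"
      unfolding edges_ring_graph using j n by (auto simp: nat_less_iff intro!: exI[of _ "y - z"])
    then show "Some j \<in> nbrs (wheel r n) (pos n z)"
      by (simp add: nbrs_def pos_def edges_wheel_Some)
  qed
  show ?thesis
  proof (rule set_eqI)
    fix w show "w \<in> nbrs (wheel r n) (pos n z) \<longleftrightarrow> w \<in> insert None (pos n ` nhd r z)"
      using None Some by (cases w) auto
  qed
qed

lemma inj_on_pos_nhd: "2 * r < n \<Longrightarrow> inj_on (pos n) (nhd r z)"
  by (rule inj_on_subset[OF inj_on_pos[of n "z - int r"]]) (auto simp: nhd_def)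

lemma None_notin_pos: "None \<notin> pos n ` X"
  by (auto simp: pos_def)

lemma threshold_wheel_pos:
  assumes "2 * r < n"
  shows "\<lceil>(real (deg (wheel r n) (pos n z)) + 1) / 2\<rceil> = int r + 1"
proof -
  have "deg (wheel r n) (pos n z) = 2 * r + 1"
    using assms by (simp add: deg_def nbrs_wheel_pos card_image inj_on_pos_nhd None_notin_pos)
  then show ?thesis by (simp add: ceiling_eq_iff)
qed

lemma card_nbrs_wheel_Int:
  assumes "2 * r < n"
  shows "card (nbrs (wheel r n) (pos n z) \<inter> S) =
    card {y \<in> nhd r z. pos n y \<in> S} + (if None \<in> S then 1 else 0)"
proof -
  have "pos n ` nhd r z \<inter> S = pos n ` {y \<in> nhd r z. pos n y \<in> S}" by auto
  moreover have "card (pos n ` {y \<in> nhd r z. pos n y \<in> S}) = card {y \<in> nhd r z. pos n y \<in> S}"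
    by (rule card_image) (rule inj_on_subset[OF inj_on_pos_nhd[OF assms]], auto)
  moreover have "None \<notin> pos n ` {y \<in> nhd r z. pos n y \<in> S}"
    by (rule None_notin_pos)
  ultimately show ?thesis
    by (simp add: nbrs_wheel_pos[OF assms] Int_insert_left)
qed

lemma final_active_wheel_posI:
  assumes "2 * r < n"
    and "r + 1 \<le> card {y \<in> nhd r z. pos n y \<in> final_active (wheel r n) A}
          + (if None \<in> final_active (wheel r n) A then 1 else 0)"
  shows "pos n z \<in> final_active (wheel r n) A"
proof (rule final_activeI)
  show "pos n z \<in> verts (wheel r n)"
    using pos_in_verts[of n z] assms(1) by (simp add: verts_wheel)
qed (use assms in \<open>simp_all add: finite_simple_graph_wheel threshold_wheel_pos card_nbrs_wheel_Int\<close>)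

lemma final_active_wheel_NoneI:
  assumes "n + 1 \<le> 2 * card {i. i < n \<and> Some i \<in> final_active (wheel r n) A}"
  shows "None \<in> final_active (wheel r n) A"
proof (rule final_activeI)
  let ?F = "final_active (wheel r n) A"
  have "Some ` {..<n} \<inter> ?F = Some ` {i. i < n \<and> Some i \<in> ?F}" by auto
  then have "card (Some ` {..<n} \<inter> ?F) = card {i. i < n \<and> Some i \<in> ?F}"
    by (simp add: card_image)
  then show "\<lceil>(real (deg (wheel r n) None) + 1) / 2\<rceil> \<le> int (card (nbrs (wheel r n) None \<inter> ?F))"
    using assms by (simp add: nbrs_wheel_None deg_def card_image ceiling_le_iff)
qed (simp_all add: finite_simple_graph_wheel verts_wheel)

text \<open>Such an \<open>S\<close> is stable under a step of the whole wheel: ring vertices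
  outside it see at most \<open>r\<close> members of \<open>S\<close> and get no help from the hub,
  and the hub sees at most half of its neighbours.\<close>

lemma not_percolates_wheelI:
  assumes "2 * r < n" "A \<subseteq> S" "None \<notin> S"
    and closed: "\<And>z. pos n z \<notin> S \<Longrightarrow> card {y \<in> nhd r z. pos n y \<in> S} \<le> r"
    and "2 * card {i. i < n \<and> Some i \<in> S} \<le> n"
  shows "\<not> percolates (wheel r n) A"
proof -
  have "Some ` {..<n} \<inter> S = Some ` {i. i < n \<and> Some i \<in> S}" by auto
  then have hub: "card (nbrs (wheel r n) None \<inter> S) = card {i. i < n \<and> Some i \<in> S}"
    by (simp add: card_image nbrs_wheel_None)
  have "mbp_step (wheel r n) S \<subseteq> S"
  proof -
    have False if "v \<in> verts (wheel r n)" "v \<notin> S"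
      and thr: "\<lceil>(real (deg (wheel r n) v) + 1) / 2\<rceil> \<le> int (card (nbrs (wheel r n) v \<inter> S))" for v
    proof (cases v)
      case None
      have "real n + 1 \<le> 2 * real (card {i. i < n \<and> Some i \<in> S})"
        using thr hub None
        by (simp add: deg_def nbrs_wheel_None card_image ceiling_le_iff mult.commute)
      then show False using assms(5) by linarith
    next
      case (Some i)
      then have "i < n" using that(1) by (auto simp: verts_wheel)
      then have v: "v = pos n (int i)" by (simp add: Some pos_of_nat)
      then show False
        using thr closed[of "int i"] that(2) assms(1,3)
        by (simp add: threshold_wheel_pos card_nbrs_wheel_Int)
    qed
    then show ?thesis by (auto simp: mbp_step_def)
  qed
  then have "final_active (wheel r n) A \<subseteq> S"
    by (rule final_active_subset[OF finite_simple_graph_wheel assms(2)])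
  then show ?thesis
    using assms(3) by (auto simp: percolates_iff verts_wheel)
qed

subsection \<open>Independent Bernoulli variables\<close>

lemma prob_pmf_not: "measure_pmf.prob M {x. \<not> P x} = 1 - measure_pmf.prob M {x. P x}"
  using measure_pmf.prob_compl[of "{x. P x}" M]
  by (simp add: Collect_neg_eq Compl_eq_Diff_UNIV)

text \<open>The product measure on \<open>V\<close> is the image of a pair of independent
  configurations on \<open>D\<close> and \<open>V - D\<close>, and under this map the event becomes
  a rectangle.\<close>

lemma prob_Pi_pmf_Int_complement:
  assumes "finite V" "D \<subseteq> V"
    and E: "\<And>f g. (\<forall>v\<in>D. f v = g v) \<Longrightarrow> E f = E g"
    and E': "\<And>f g. (\<forall>v\<in>V - D. f v = g v) \<Longrightarrow> E' f = E' g"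
  shows "measure_pmf.prob (Pi_pmf V d P) {f. E f \<and> E' f} =
    measure_pmf.prob (Pi_pmf D d P) {f. E f} * measure_pmf.prob (Pi_pmf (V - D) d P) {f. E' f}"
proof -
  let ?h = "\<lambda>(f, g) x. if x \<in> D then f x else g x"
  let ?M = "Pi_pmf D d P" and ?N = "Pi_pmf (V - D) d P"
  have "Pi_pmf (D \<union> (V - D)) d P = map_pmf ?h (pair_pmf ?M ?N)"
    using assms(1,2) by (intro Pi_pmf_union) (auto intro: finite_subset)
  moreover have "D \<union> (V - D) = V" using assms(2) by blast
  ultimately have "measure_pmf.prob (Pi_pmf V d P) {f. E f \<and> E' f} =
      measure_pmf.prob (pair_pmf ?M ?N) (?h -` {f. E f \<and> E' f})"
    by simp
  also have "?h -` {f. E f \<and> E' f} = {f. E f} \<times> {f. E' f}"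
  proof -
    have "E (?h (f, g)) = E f" "E' (?h (f, g)) = E' g" for f g
      by (rule E, simp) (rule E', simp)
    then show ?thesis by auto
  qed
  \<comment> \<open>The product rule asks for countable sets, so both sides of the rectangle are cut
    down to the supports, which leaves the probabilities unchanged.\<close>
  also have "measure_pmf.prob (pair_pmf ?M ?N) ({f. E f} \<times> {f. E' f}) =
      measure_pmf.prob (pair_pmf ?M ?N) (({f. E f} \<inter> set_pmf ?M) \<times> ({f. E' f} \<inter> set_pmf ?N))"
    by (subst (1) measure_Int_set_pmf [symmetric]) (simp only: set_pair_pmf Times_Int_Times)
  also have "\<dots> = measure_pmf.prob ?M ({f. E f} \<inter> set_pmf ?M) * measure_pmf.prob ?N ({f. E' f} \<inter> set_pmf ?N)"
    by (rule measure_pmf_prob_product) (auto intro: countable_Int2)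
  finally show ?thesis by (simp only: measure_Int_set_pmf)
qed

lemma prob_Pi_pmf_subset:
  assumes "finite V" "D \<subseteq> V" "\<And>f g. (\<forall>v\<in>D. f v = g v) \<Longrightarrow> E f = E g"
  shows "measure_pmf.prob (Pi_pmf V d P) {f. E f} = measure_pmf.prob (Pi_pmf D d P) {f. E f}"
  using prob_Pi_pmf_Int_complement[OF assms(1,2), where E = E and E' = "\<lambda>_. True" and d = d and P = P]
    assms(3) by simp

lemma prob_Pi_pmf_disjoint_family:
  assumes "finite V" "finite I" "disjoint_family_on D I" "\<And>i. i \<in> I \<Longrightarrow> D i \<subseteq> V"
    and "\<And>i f g. i \<in> I \<Longrightarrow> (\<forall>v\<in>D i. f v = g v) \<Longrightarrow> E i f = E i g"
  shows "measure_pmf.prob (Pi_pmf V d P) {f. \<forall>i\<in>I. E i f} =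
    (\<Prod>i\<in>I. measure_pmf.prob (Pi_pmf V d P) {f. E i f})"
  using assms(2-5)
proof (induction I rule: finite_induct)
  case (insert j I)
  have D: "D j \<subseteq> V" and Ej: "\<And>f g. (\<forall>v\<in>D j. f v = g v) \<Longrightarrow> E j f = E j g"
    using insert.prems by blast+
  have disj: "D i \<subseteq> V - D j" if "i \<in> I" for i
    using that insert.prems(1,2) insert.hyps(2) by (fastforce simp: disjoint_family_on_def)
  have EI: "(\<forall>i\<in>I. E i f) = (\<forall>i\<in>I. E i g)" if "\<forall>v\<in>V - D j. f v = g v" for f g
  proof -
    have "E i f = E i g" if "i \<in> I" for i
      using \<open>\<forall>v\<in>V - D j. f v = g v\<close> disj[OF that] that
      by (intro insert.prems(3)) auto
    then show ?thesis by blast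
  qed
  have "measure_pmf.prob (Pi_pmf V d P) {f. \<forall>i\<in>insert j I. E i f} =
      measure_pmf.prob (Pi_pmf V d P) {f. E j f \<and> (\<forall>i\<in>I. E i f)}"
    by simp
  also have "\<dots> = measure_pmf.prob (Pi_pmf (D j) d P) {f. E j f} *
      measure_pmf.prob (Pi_pmf (V - D j) d P) {f. \<forall>i\<in>I. E i f}"
    by (rule prob_Pi_pmf_Int_complement[OF assms(1) D Ej EI])
  also have "measure_pmf.prob (Pi_pmf (D j) d P) {f. E j f} = measure_pmf.prob (Pi_pmf V d P) {f. E j f}"
    by (rule prob_Pi_pmf_subset[symmetric, OF assms(1) D Ej])
  also have "measure_pmf.prob (Pi_pmf (V - D j) d P) {f. \<forall>i\<in>I. E i f} =
      measure_pmf.prob (Pi_pmf V d P) {f. \<forall>i\<in>I. E i f}"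
    by (rule prob_Pi_pmf_subset[symmetric, OF assms(1) Diff_subset EI])
  also have "\<dots> = (\<Prod>i\<in>I. measure_pmf.prob (Pi_pmf V d P) {f. E i f})"
  proof (rule insert.IH)
    show "disjoint_family_on D I"
      using insert.prems(1) by (rule disjoint_family_on_mono[rotated]) blast
  qed (use insert.prems in blast)+
  finally show ?case
    using insert.hyps by simp
qed simp

lemma prob_card_active:
  assumes "finite V" "D \<subseteq> V" "p \<in> {0..1}"
  shows "measure_pmf.prob (Pi_pmf V False (\<lambda>_. bernoulli_pmf p)) {f. Q (card {v \<in> D. f v})} =
    measure_pmf.prob (binomial_pmf (card D) p) {k. Q k}"
proof -
  have fin: "finite D" using assms by (blast intro: finite_subset)
  have "measure_pmf.prob (Pi_pmf V False (\<lambda>_. bernoulli_pmf p)) {f. Q (card {v \<in> D. f v})} =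
      measure_pmf.prob (Pi_pmf D False (\<lambda>_. bernoulli_pmf p)) {f. Q (card {v \<in> D. f v})}"
  proof (rule prob_Pi_pmf_subset[OF assms(1,2)])
    fix f g :: "'a \<Rightarrow> bool" assume "\<forall>v\<in>D. f v = g v"
    then have "{v \<in> D. f v} = {v \<in> D. g v}" by auto
    then show "Q (card {v \<in> D. f v}) = Q (card {v \<in> D. g v})" by simp
  qed
  also have "\<dots> = measure_pmf.prob (map_pmf (\<lambda>f. card {v \<in> D. f v}) (Pi_pmf D False (\<lambda>_. bernoulli_pmf p))) {k. Q k}"
    by (simp add: vimage_def)
  also have "\<dots> = measure_pmf.prob (binomial_pmf (card D) p) {k. Q k}"
    using binomial_pmf_altdef'[OF fin refl assms(3), of False] by simp
  finally show ?thesis .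
qed

lemma prob_all_passive:
  assumes "finite V" "D \<subseteq> V" "p \<in> {0..1}"
  shows "measure_pmf.prob (Pi_pmf V False (\<lambda>_. bernoulli_pmf p)) {f. \<forall>v\<in>D. \<not> f v} = (1 - p) ^ card D"
proof -
  have "finite D" using assms by (blast intro: finite_subset)
  then have "(\<forall>v\<in>D. \<not> f v) \<longleftrightarrow> card {v \<in> D. f v} = 0" for f
    by auto
  then have "measure_pmf.prob (Pi_pmf V False (\<lambda>_. bernoulli_pmf p)) {f. \<forall>v\<in>D. \<not> f v} =
      measure_pmf.prob (binomial_pmf (card D) p) {k. k = 0}"
    using prob_card_active[OF assms, of "\<lambda>k. k = 0"] by simp
  also have "\<dots> = pmf (binomial_pmf (card D) p) 0"
    by (simp add: measure_pmf_single)
  finally show ?thesis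
    using assms(3) by simp
qed

lemma prob_no_passive_block:
  assumes "finite V" "finite I" "disjoint_family_on D I" "\<And>i. i \<in> I \<Longrightarrow> D i \<subseteq> V"
    and "\<And>i. i \<in> I \<Longrightarrow> card (D i) = s" "p \<in> {0..1}"
  shows "measure_pmf.prob (Pi_pmf V False (\<lambda>_. bernoulli_pmf p)) {f. \<forall>i\<in>I. \<exists>v\<in>D i. f v} =
    (1 - (1 - p) ^ s) ^ card I"
proof -
  have "measure_pmf.prob (Pi_pmf V False (\<lambda>_. bernoulli_pmf p)) {f. \<exists>v\<in>D i. f v} = 1 - (1 - p) ^ s"
    if "i \<in> I" for i
  proof -
    have "measure_pmf.prob (Pi_pmf V False (\<lambda>_. bernoulli_pmf p)) {f. \<not> (\<forall>v\<in>D i. \<not> f v)} = 1 - (1 - p) ^ s"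
      unfolding prob_pmf_not prob_all_passive[OF assms(1) assms(4)[OF that] assms(6)] assms(5)[OF that] ..
    then show ?thesis by simp
  qed
  moreover have "measure_pmf.prob (Pi_pmf V False (\<lambda>_. bernoulli_pmf p)) {f. \<forall>i\<in>I. \<exists>v\<in>D i. f v} =
      (\<Prod>i\<in>I. measure_pmf.prob (Pi_pmf V False (\<lambda>_. bernoulli_pmf p)) {f. \<exists>v\<in>D i. f v})"
    by (rule prob_Pi_pmf_disjoint_family[OF assms(1-4)]) auto
  ultimately show ?thesis by simp
qed

text \<open>For \<open>k = r + d\<close> the weight is \<open>(p (1-p))^(r-d) * (p^2)^d\<close>, at
  most \<open>(p (1-p))^r\<close> because \<open>p \<le> 1 - p\<close>; the binomial coefficients
  add up to at most \<open>4^r\<close>.\<close>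

lemma binomial_majority_le:
  assumes "0 \<le> p" "p \<le> 1 / 2"
  shows "measure_pmf.prob (binomial_pmf (2 * r) p) {k. r + 1 \<le> k} \<le> (4 * p * (1 - p)) ^ r"
proof -
  have p: "p \<in> {0..1}" using assms by simp
  have "measure_pmf.prob (binomial_pmf (2 * r) p) {k. r + 1 \<le> k} =
      measure_pmf.prob (binomial_pmf (2 * r) p) ({k. r + 1 \<le> k} \<inter> set_pmf (binomial_pmf (2 * r) p))"
    by (simp only: measure_Int_set_pmf)
  also have "\<dots> \<le> measure_pmf.prob (binomial_pmf (2 * r) p) {r+1..2*r}"
    using p by (intro measure_pmf.finite_measure_mono) (auto simp: set_pmf_binomial_eq split: if_splits)
  also have "\<dots> = (\<Sum>k\<in>{r+1..2*r}. pmf (binomial_pmf (2 * r) p) k)"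
    by (simp add: measure_measure_pmf_finite)
  also have "\<dots> \<le> (\<Sum>k\<in>{r+1..2*r}. real ((2 * r) choose k) * (p * (1 - p)) ^ r)"
  proof (rule sum_mono)
    fix k assume k: "k \<in> {r+1..2*r}"
    define d where "d = k - r"
    then have kd: "k = r + d" "2 * r - k = r - d" "d \<le> r" using k by auto
    have "p ^ k * (1 - p) ^ (2 * r - k) = (p * (1 - p)) ^ (r - d) * (p * p) ^ d"
    proof -
      have "p ^ k = p ^ (r - d) * (p * p) ^ d"
        using kd by (simp add: add.commute flip: power_add power2_eq_square power_mult)
      then show ?thesis by (simp add: kd(2) power_mult_distrib)
    qed
    also have "\<dots> \<le> (p * (1 - p)) ^ (r - d) * (p * (1 - p)) ^ d"
      using assms by (intro mult_left_mono power_mono) auto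
    also have "\<dots> = (p * (1 - p)) ^ r"
      using kd(3) by (simp flip: power_add)
    finally show "pmf (binomial_pmf (2 * r) p) k \<le> real ((2 * r) choose k) * (p * (1 - p)) ^ r"
      using p by (simp add: mult.assoc mult_left_mono)
  qed
  also have "\<dots> = real (\<Sum>k\<in>{r+1..2*r}. (2 * r) choose k) * (p * (1 - p)) ^ r"
    by (simp add: sum_distrib_right)
  also have "\<dots> \<le> 4 ^ r * (p * (1 - p)) ^ r"
  proof (rule mult_right_mono)
    have "(\<Sum>k\<in>{r+1..2*r}. (2 * r) choose k) \<le> (\<Sum>k\<in>{..2*r}. (2 * r) choose k)"
      by (rule sum_mono2) auto
    also have "\<dots> = 4 ^ r"
      by (simp add: choose_row_sum power_mult)
    finally show "real (\<Sum>k\<in>{r+1..2*r}. (2 * r) choose k) \<le> 4 ^ r"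
      by (metis of_nat_le_iff of_nat_numeral of_nat_power)
  qed (use assms in simp)
  finally show ?thesis by (simp add: power_mult_distrib mult.assoc)
qed

subsection \<open>Below \<open>1/4\<close>: blocking\<close>

definition ring_closed :: "nat \<Rightarrow> nat \<Rightarrow> nat option set \<Rightarrow> bool" where
  "ring_closed n r S \<longleftrightarrow> (\<forall>z. pos n z \<notin> S \<longrightarrow> card {y \<in> nhd r z. pos n y \<in> S} \<le> r)"

text \<open>
  The set activated by the ring dynamics alone, i.e. with threshold \<open>r + 1\<close> and no hub.
\<close>

definition ring_hull :: "nat \<Rightarrow> nat \<Rightarrow> nat option set \<Rightarrow> nat option set" where
  "ring_hull n r A = \<Inter> {S. A \<subseteq> S \<and> S \<subseteq> range Some \<and> ring_closed n r S}"

lemma subset_ring_hull: "A \<subseteq> ring_hull n r A"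
  by (auto simp: ring_hull_def)

text \<open>\<open>range Some\<close> belongs to the intersected family, which is therefore
  nonempty; this is what keeps the hub out of the hull.\<close>

lemma ring_hull_subset_range:
  assumes "A \<subseteq> range Some"
  shows "ring_hull n r A \<subseteq> range Some"
proof -
  have "ring_closed n r (range Some)"
    by (simp add: ring_closed_def pos_def)
  with assms show ?thesis
    unfolding ring_hull_def by blast
qed

lemma ring_closed_ring_hull: "ring_closed n r (ring_hull n r A)"
  unfolding ring_closed_def
proof (intro allI impI)
  fix z assume "pos n z \<notin> ring_hull n r A"
  then obtain S where S: "A \<subseteq> S" "S \<subseteq> range Some" "ring_closed n r S" "pos n z \<notin> S"
    unfolding ring_hull_def by blast
  then have "ring_hull n r A \<subseteq> S"
    unfolding ring_hull_def by blast
  then have "card {y \<in> nhd r z. pos n y \<in> ring_hull n r A} \<le> card {y \<in> nhd r z. pos n y \<in> S}"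
    by (intro card_mono) auto
  also have "\<dots> \<le> r"
    using S(3,4) by (simp add: ring_closed_def)
  finally show "card {y \<in> nhd r z. pos n y \<in> ring_hull n r A} \<le> r" .
qed

text \<open>\<open>ring_closed\<close> speaks of all integers, while bounds are obtained for one
  chosen representative of a ring vertex; shifting by whole turns transfers them.\<close>

lemma card_nhd_shift:
  "card {y' \<in> nhd r (y + k * int n). pos n y' \<in> S} = card {y' \<in> nhd r y. pos n y' \<in> S}"
proof -
  have "{y' \<in> nhd r (y + k * int n). pos n y' \<in> S} = (\<lambda>t. t + k * int n) ` {y' \<in> nhd r y. pos n y' \<in> S}"
  proof (rule set_eqI)
    fix t
    have "t \<in> {y' \<in> nhd r (y + k * int n). pos n y' \<in> S} \<longleftrightarrow> t - k * int n \<in> {y' \<in> nhd r y. pos n y' \<in> S}"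
      using pos_add_mult[of n "t - k * int n" k] by (auto simp: nhd_def)
    also have "\<dots> \<longleftrightarrow> t \<in> (\<lambda>t. t + k * int n) ` {y' \<in> nhd r y. pos n y' \<in> S}"
      by (metis (no_types, lifting) add_diff_cancel_right' diff_add_cancel image_iff)
    finally show "t \<in> {y' \<in> nhd r (y + k * int n). pos n y' \<in> S} \<longleftrightarrow>
        t \<in> (\<lambda>t. t + k * int n) ` {y' \<in> nhd r y. pos n y' \<in> S}" .
  qed
  then show ?thesis by (simp add: card_image)
qed

text \<open>
  Even if everything outside \<open>{a..b + r}\<close> is active, the two passive blocks of length \<open>r + 1\<close> hold:
  the \<open>j\<close>-th vertex of a block sees at most \<open>r - j + 1\<close> active vertices on one side of the block
  and \<open>j - 1\<close> on the other.
\<close>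

lemma notin_ring_hull_if_enclosed:
  assumes "n > 0" "A \<subseteq> range Some"
    and left: "\<And>y. y \<in> {a..a + int r} \<Longrightarrow> pos n y \<notin> A"
    and right: "\<And>y. y \<in> {b..b + int r} \<Longrightarrow> pos n y \<notin> A"
    and x: "a + int r < x" "x < b" "pos n x \<notin> A"
    and sparse: "\<And>y. y \<in> {a..b + int r} \<Longrightarrow> card {y' \<in> nhd r y. pos n y' \<in> A} \<le> r"
  shows "pos n x \<notin> ring_hull n r A"
proof -
  define B where "B = {y \<in> {a..b + int r}. pos n y \<notin> A}"
  \<comment> \<open>The most active scenario compatible with the two blocks: every ring vertex
    except those initially passive in \<open>{a..b + r}\<close>. It is shown to be closed.\<close>
  define S where "S = range Some - pos n ` B"
  have inA: "pos n y \<in> A" if "y \<in> {a..b + int r}" "pos n y \<in> S" for y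
    using that by (auto simp: S_def B_def)
  have bound: "card {y' \<in> nhd r y. pos n y' \<in> S} \<le> r" if y: "y \<in> B" for y
  proof -
    have yab: "a \<le> y" "y \<le> b + int r" using y by (auto simp: B_def)
    consider "y \<le> a + int r" | "a + int r < y" "y < b" | "b \<le> y" by linarith
    then show ?thesis
    proof cases
      case 1
      have "{y' \<in> nhd r y. pos n y' \<in> S} \<subseteq> {y - int r..a - 1} \<union> {a + int r + 1..y + int r}"
      proof
        fix t assume t: "t \<in> {y' \<in> nhd r y. pos n y' \<in> S}"
        have "t \<notin> {a..a + int r}" using inA[of t] left[of t] t x by auto
        with t show "t \<in> {y - int r..a - 1} \<union> {a + int r + 1..y + int r}"
          by (auto simp: nhd_def)
      qed
      then have "card {y' \<in> nhd r y. pos n y' \<in> S} \<le> card ({y - int r..a - 1} \<union> {a + int r + 1..y + int r})"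
        by (intro card_mono) auto
      also have "\<dots> \<le> card {y - int r..a - 1} + card {a + int r + 1..y + int r}"
        by (rule card_Un_le)
      also have "\<dots> = r" using 1 yab by simp
      finally show ?thesis .
    next
      \<comment> \<open>The window of a vertex strictly between the blocks stays inside
        \<open>{a..b + r}\<close>, where membership in \<open>S\<close> means initial activity, so
        \<open>sparse\<close> applies.\<close>
      case 2
      have "card {y' \<in> nhd r y. pos n y' \<in> S} \<le> card {y' \<in> nhd r y. pos n y' \<in> A}"
      proof (intro card_mono subsetI)
        fix t assume t: "t \<in> {y' \<in> nhd r y. pos n y' \<in> S}"
        then have "t \<in> {a..b + int r}" using 2 by (auto simp: nhd_def)
        with t inA show "t \<in> {y' \<in> nhd r y. pos n y' \<in> A}" by blast
      qed simp
      also have "\<dots> \<le> r" using yab by (intro sparse) simp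
      finally show ?thesis .
    next
      case 3
      have "{y' \<in> nhd r y. pos n y' \<in> S} \<subseteq> {y - int r..b - 1} \<union> {b + int r + 1..y + int r}"
      proof
        fix t assume t: "t \<in> {y' \<in> nhd r y. pos n y' \<in> S}"
        have "t \<notin> {b..b + int r}" using inA[of t] right[of t] t x by auto
        with t show "t \<in> {y - int r..b - 1} \<union> {b + int r + 1..y + int r}"
          by (auto simp: nhd_def)
      qed
      then have "card {y' \<in> nhd r y. pos n y' \<in> S} \<le> card ({y - int r..b - 1} \<union> {b + int r + 1..y + int r})"
        by (intro card_mono) auto
      also have "\<dots> \<le> card {y - int r..b - 1} + card {b + int r + 1..y + int r}"
        by (rule card_Un_le)
      also have "\<dots> = r" using 3 yab by simp
      finally show ?thesis .
    qed
  qed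
  have "ring_closed n r S"
    unfolding ring_closed_def
  proof (intro allI impI)
    fix z assume "pos n z \<notin> S"
    then obtain y where y: "y \<in> B" "pos n z = pos n y"
      by (auto simp: S_def pos_def)
    obtain k where "z = y + k * int n"
      using pos_eqE[OF assms(1) y(2)] .
    then show "card {y \<in> nhd r z. pos n y \<in> S} \<le> r"
      using bound[OF y(1)] by (simp add: card_nhd_shift)
  qed
  moreover have "A \<subseteq> S" "S \<subseteq> range Some"
    using assms(2) by (auto simp: S_def B_def)
  moreover have "pos n x \<notin> S"
    using x by (auto simp: S_def B_def)
  ultimately show ?thesis
    unfolding ring_hull_def by blast
qed

lemma block_subset:
  fixes i m s :: nat
  assumes "i < m"
  shows "int i * int s + int s \<le> int m * int s"
proof -
  have "Suc i * s \<le> m * s" using assms by (intro mult_right_mono) auto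
  then have "int (Suc i * s) \<le> int (m * s)" by (simp only: of_nat_le_iff)
  then show ?thesis by (simp add: algebra_simps)
qed

text \<open>All blocks fit into a single turn of the ring, on which \<open>pos\<close> is
  injective.\<close>

lemma disjoint_blocks:
  fixes a :: int
  assumes "m * s \<le> n" "\<And>i. i \<in> I \<Longrightarrow> i < m"
  shows "disjoint_family_on (\<lambda>i. pos n ` {a + int i * int s..<a + int i * int s + int s}) I"
proof -
  have sub: "{a + int i * int s..<a + int i * int s + int s} \<subseteq> {a..<a + int n}" if "i \<in> I" for i
  proof -
    have "int m * int s \<le> int n"
      using assms(1) by (metis of_nat_le_iff of_nat_mult)
    then show ?thesis using block_subset[of i m s] assms(2)[OF that] by auto
  qed
  have *: "{a + int i * int s..<a + int i * int s + int s} \<inter> {a + int j * int s..<a + int j * int s + int s} = {}"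
    if "i < j" for i j :: nat
    using block_subset[OF that, of s] by auto
  have "{a + int i * int s..<a + int i * int s + int s} \<inter> {a + int j * int s..<a + int j * int s + int s} = {}"
    if "i \<noteq> j" for i j :: nat
    using *[of i j] *[of j i] that by (cases i j rule: linorder_cases) blast+
  then show ?thesis
    using inj_on_image_Int[OF inj_on_pos[of n a] sub sub, symmetric]
    by (auto simp: disjoint_family_on_def)
qed

lemma card_block:
  assumes "s \<le> n"
  shows "card (pos n ` {a..<a + int s}) = s"
  using assms inj_on_subset[OF inj_on_pos[of n a], of "{a..<a + int s}"] by (simp add: card_image)

lemma pos_image_subset_verts: "n > 0 \<Longrightarrow> pos n ` X \<subseteq> verts (wheel r n)"
  using pos_in_verts by (auto simp: verts_wheel)

lemma finite_verts_wheel: "finite (verts (wheel r n))"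
  by (simp add: verts_wheel)

lemma prob_active:
  assumes "finite V" "v \<in> V" "p \<in> {0..1}"
  shows "measure_pmf.prob (Pi_pmf V False (\<lambda>_. bernoulli_pmf p)) {f. f v} = p"
  using prob_no_passive_block[of V "{0::nat}" "\<lambda>_. {v}" 1 p] assms
  by (simp add: disjoint_family_on_def)

text \<open>Union bound over the ways in which the enclosure of \<open>x\<close> can fail:
  \<open>x\<close> is initially active; all \<open>m\<close> disjoint blocks of length
  \<open>r + 1\<close> on one side, left or right, contain an active vertex; or some position within
  reach of these blocks sees an initial majority.\<close>

lemma prob_in_ring_hull_le:
  assumes "2 * (m * (r + 1)) + 2 * r < n" "0 \<le> p" "p \<le> 1 / 2"
  shows "measure_pmf.prob (Pi_pmf (verts (wheel r n)) False (\<lambda>_. bernoulli_pmf p))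
      {f. pos n x \<in> ring_hull n r {v \<in> Some ` {..<n}. f v}} \<le>
    p + 2 * (1 - (1 - p) ^ (r + 1)) ^ m + (2 * real m * (real r + 1) + 1) * (4 * p * (1 - p)) ^ r"
    (is "measure_pmf.prob ?M ?H \<le> _")
proof -
  define s where "s = r + 1"
  have n: "n > 0" "2 * r < n" "m * s \<le> n" using assms(1) by (auto simp: s_def)
  have p: "p \<in> {0..1}" using assms by simp
  define L where "L = x - int m * int s"
  define D D' where "D = (\<lambda>i. pos n ` {L + int i * int s..<L + int i * int s + int s})"
    and "D' = (\<lambda>i. pos n ` {x + 1 + int i * int s..<x + 1 + int i * int s + int s})"
  \<comment> \<open>All positions that may lie between the two chosen blocks or in them, whichever
    blocks are chosen: \<open>2 m (r + 1) + 1\<close> integers.\<close>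
  define Y where "Y = {L..x + int m * int s}"
  define E1 where "E1 = {f. f (pos n x)}"
  define E2 where "E2 = {f. \<forall>i\<in>{..<m}. \<exists>v\<in>D i. f v}"
  define E3 where "E3 = {f. \<forall>i\<in>{..<m}. \<exists>v\<in>D' i. f v}"
  define E4 where "E4 = (\<Union>y\<in>Y. {f. r + 1 \<le> card {v \<in> pos n ` nhd r y. f v}})"
  have "?H \<subseteq> E1 \<union> E2 \<union> E3 \<union> E4"
  proof (rule ccontr)
    assume "\<not> ?H \<subseteq> E1 \<union> E2 \<union> E3 \<union> E4"
    then obtain f where f: "f \<in> ?H" "f \<notin> E1" "f \<notin> E2" "f \<notin> E3" "f \<notin> E4" by blast
    let ?A = "{v \<in> Some ` {..<n}. f v}"
    have inA: "pos n y \<in> ?A \<longleftrightarrow> f (pos n y)" for y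
      using pos_in_verts[OF n(1)] by auto
    obtain i where i: "i < m" "\<And>v. v \<in> D i \<Longrightarrow> \<not> f v"
      using f(3) by (auto simp: E2_def)
    obtain j where j: "j < m" "\<And>v. v \<in> D' j \<Longrightarrow> \<not> f v"
      using f(4) by (auto simp: E3_def)
    let ?a = "L + int i * int s" and ?b = "x + 1 + int j * int s"
    have "pos n x \<notin> ring_hull n r ?A"
    proof (rule notin_ring_hull_if_enclosed[OF n(1), where a = ?a and b = ?b])
      show "?a + int r < x"
        using block_subset[OF i(1), of s] by (simp add: L_def s_def)
      show "x < ?b" by (simp add: add_strict_increasing)
      show "pos n y \<notin> ?A" if "y \<in> {?a..?a + int r}" for y
        using i(2)[of "pos n y"] that by (auto simp: D_def s_def)
      show "pos n y \<notin> ?A" if "y \<in> {?b..?b + int r}" for y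
        using j(2)[of "pos n y"] that by (auto simp: D'_def s_def)
      show "pos n x \<notin> ?A" using f(2) by (simp add: E1_def)
      show "card {y' \<in> nhd r y. pos n y' \<in> ?A} \<le> r" if "y \<in> {?a..?b + int r}" for y
      proof -
        have "0 \<le> int i * int s" by simp
        then have "y \<in> Y"
          using that block_subset[OF j(1), of s] unfolding Y_def s_def atLeastAtMost_iff
          by (auto simp del: of_nat_mult mult_nonneg_nonneg)
        then have "card {v \<in> pos n ` nhd r y. f v} \<le> r"
          using f(5) by (force simp: E4_def)
        moreover have "{v \<in> pos n ` nhd r y. f v} = pos n ` {y' \<in> nhd r y. pos n y' \<in> ?A}"
          using inA by auto
        moreover have "card (pos n ` {y' \<in> nhd r y. pos n y' \<in> ?A}) = card {y' \<in> nhd r y. pos n y' \<in> ?A}"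
          by (rule card_image, rule inj_on_subset[OF inj_on_pos_nhd[OF n(2), of y]]) blast
        ultimately show ?thesis by simp
      qed
    qed auto
    with f(1) show False by simp
  qed
  then have "measure_pmf.prob ?M ?H \<le> measure_pmf.prob ?M (E1 \<union> E2 \<union> E3 \<union> E4)"
    by (rule measure_pmf.finite_measure_mono) simp
  also have "\<dots> \<le> measure_pmf.prob ?M E1 + measure_pmf.prob ?M E2 + measure_pmf.prob ?M E3 + measure_pmf.prob ?M E4"
    by (intro order_trans[OF measure_Un_le] add_mono) auto
  also have "measure_pmf.prob ?M E1 = p"
    unfolding E1_def using pos_image_subset_verts[OF n(1), of "{x}" r]
    by (intro prob_active[OF finite_verts_wheel _ p]) simp
  also have "measure_pmf.prob ?M E2 = (1 - (1 - p) ^ s) ^ card {..<m}"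
    unfolding E2_def
  proof (rule prob_no_passive_block[OF finite_verts_wheel _ _ _ _ p])
    show "disjoint_family_on D {..<m}"
      unfolding D_def using n(3) by (intro disjoint_blocks[of m]) auto
    show "card (D i) = s" for i
      unfolding D_def using n(2) assms(1) by (intro card_block) (simp add: s_def)
    show "D i \<subseteq> verts (wheel r n)" for i
      unfolding D_def using n(1) by (rule pos_image_subset_verts)
  qed simp
  also have "measure_pmf.prob ?M E3 = (1 - (1 - p) ^ s) ^ card {..<m}"
    unfolding E3_def
  proof (rule prob_no_passive_block[OF finite_verts_wheel _ _ _ _ p])
    show "disjoint_family_on D' {..<m}"
      unfolding D'_def using n(3) by (intro disjoint_blocks[of m]) auto
    show "card (D' i) = s" for i
      unfolding D'_def using n(2) assms(1) by (intro card_block) (simp add: s_def)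
    show "D' i \<subseteq> verts (wheel r n)" for i
      unfolding D'_def using n(1) by (rule pos_image_subset_verts)
  qed simp
  also have "measure_pmf.prob ?M E4 \<le> (2 * real m * (real r + 1) + 1) * (4 * p * (1 - p)) ^ r"
  proof -
    have "measure_pmf.prob ?M E4 \<le> (\<Sum>y\<in>Y. measure_pmf.prob ?M {f. r + 1 \<le> card {v \<in> pos n ` nhd r y. f v}})"
      unfolding E4_def by (rule measure_pmf.finite_measure_subadditive_finite) (auto simp: Y_def)
    also have "\<dots> \<le> (\<Sum>y\<in>Y. (4 * p * (1 - p)) ^ r)"
    proof (rule sum_mono)
      fix y
      have "measure_pmf.prob ?M {f. r + 1 \<le> card {v \<in> pos n ` nhd r y. f v}} =
          measure_pmf.prob (binomial_pmf (card (pos n ` nhd r y)) p) {k. r + 1 \<le> k}"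
        by (rule prob_card_active[OF finite_verts_wheel pos_image_subset_verts[OF n(1)] p])
      also have "card (pos n ` nhd r y) = 2 * r"
        by (simp add: card_image inj_on_pos_nhd[OF n(2)])
      also have "measure_pmf.prob (binomial_pmf (2 * r) p) {k. r + 1 \<le> k} \<le> (4 * p * (1 - p)) ^ r"
        by (rule binomial_majority_le[OF assms(2,3)])
      finally show "measure_pmf.prob ?M {f. r + 1 \<le> card {v \<in> pos n ` nhd r y. f v}} \<le> (4 * p * (1 - p)) ^ r" .
    qed
    also have "\<dots> = real (card Y) * (4 * p * (1 - p)) ^ r" by simp
    also have "card Y = 2 * m * (r + 1) + 1"
    proof -
      have "x + int m * int s - L + 1 = int (2 * m * (r + 1) + 1)"
        by (simp add: L_def s_def algebra_simps)
      then show ?thesis by (simp only: Y_def card_atLeastAtMost_int nat_int)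
    qed
    finally show ?thesis by (simp add: algebra_simps)
  qed
  finally show ?thesis by (simp add: s_def)
qed

text \<open>Markov's inequality for the number of indices with \<open>P\<close>. Only the
  expectation enters, so the strong dependence between nearby vertices does no harm.\<close>

lemma prob_majority_le:
  fixes M :: "'a pmf"
  assumes "n > 0" "\<And>i. i < n \<Longrightarrow> measure_pmf.prob M {x. P i x} \<le> q"
  shows "measure_pmf.prob M {x. n < 2 * card {i. i < n \<and> P i x}} \<le> 2 * q"
proof -
  define u where "u = (\<lambda>x. \<Sum>i<n. indicator {x. P i x} x :: real)"
  have u: "u x = real (card {i. i < n \<and> P i x})" for x
  proof -
    have "u x = (\<Sum>i<n. if P i x then 1 else 0)"
      unfolding u_def by (intro sum.cong) (auto simp: indicator_def)
    also have "\<dots> = real (card ({..<n} \<inter> {i. P i x}))"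
      by (simp add: sum.If_cases)
    also have "{..<n} \<inter> {i. P i x} = {i. i < n \<and> P i x}" by auto
    finally show ?thesis .
  qed
  have int: "integrable M u"
    unfolding u_def by (intro Bochner_Integration.integrable_sum) (simp add: measure_pmf.emeasure_eq_measure)
  have "measure_pmf.prob M {x. n < 2 * card {i. i < n \<and> P i x}} \<le> measure_pmf.prob M {x \<in> UNIV. real n / 2 \<le> u x}"
    by (rule measure_pmf.finite_measure_mono) (auto simp: u)
  also have "\<dots> \<le> measure_pmf.expectation M u / (real n / 2)"
  proof -
    have "0 \<le> u x" for x by (simp add: u)
    then show ?thesis
      using integral_Markov_inequality_measure[OF int, of "{}" "real n / 2"] assms(1) by simp
  qed
  also have "measure_pmf.expectation M u = (\<Sum>i<n. measure_pmf.prob M {x. P i x})"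
    unfolding u_def by (subst Bochner_Integration.integral_sum) (simp_all add: measure_pmf.emeasure_eq_measure)
  also have "\<dots> \<le> (\<Sum>i<n. q)"
    using assms(2) by (intro sum_mono) simp
  finally show ?thesis
    using assms(1) by (simp add: field_simps)
qed

text \<open>If the hub starts passive and the ring hull covers at most half of the ring, the hull is
  a stable set without the hub. The leading \<open>p\<close> pays for an initially active hub, the
  rest for a hull above one half.\<close>

lemma percolation_prob_wheel_le:
  assumes "2 * (m * (r + 1)) + 2 * r < n" "0 \<le> p" "p \<le> 1 / 2"
  shows "percolation_prob (wheel r n) p \<le> p +
    2 * (p + 2 * (1 - (1 - p) ^ (r + 1)) ^ m + (2 * real m * (real r + 1) + 1) * (4 * p * (1 - p)) ^ r)"
proof -
  let ?M = "Pi_pmf (verts (wheel r n)) False (\<lambda>_. bernoulli_pmf p)"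
  let ?H = "\<lambda>f. ring_hull n r {v \<in> Some ` {..<n}. f v}"
  have n: "n > 0" "2 * r < n" using assms(1) by auto
  have p: "p \<in> {0..1}" using assms by simp
  have "{f. percolates (wheel r n) {v \<in> verts (wheel r n). f v}} \<subseteq>
      {f. f None} \<union> {f. n < 2 * card {i. i < n \<and> Some i \<in> ?H f}}"
  proof (intro subsetI, rule ccontr)
    fix f assume "f \<in> {f. percolates (wheel r n) {v \<in> verts (wheel r n). f v}}"
      and "f \<notin> {f. f None} \<union> {f. n < 2 * card {i. i < n \<and> Some i \<in> ?H f}}"
    then have f: "percolates (wheel r n) {v \<in> verts (wheel r n). f v}"
      "\<not> f None" "2 * card {i. i < n \<and> Some i \<in> ?H f} \<le> n"
      by (simp_all add: not_less)
    have "\<not> percolates (wheel r n) {v \<in> verts (wheel r n). f v}"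
    proof (rule not_percolates_wheelI[OF n(2) _ _ _ f(3)])
      have "{v \<in> verts (wheel r n). f v} = {v \<in> Some ` {..<n}. f v}"
        using f(2) by (auto simp: verts_wheel)
      then show "{v \<in> verts (wheel r n). f v} \<subseteq> ?H f"
        using subset_ring_hull by simp
      show "None \<notin> ?H f"
        using ring_hull_subset_range[of "{v \<in> Some ` {..<n}. f v}" n r] by blast
      show "card {y \<in> nhd r z. pos n y \<in> ?H f} \<le> r" if "pos n z \<notin> ?H f" for z
        using that ring_closed_ring_hull by (simp add: ring_closed_def)
    qed
    with f(1) show False by contradiction
  qed
  then have "percolation_prob (wheel r n) p \<le>
      measure_pmf.prob ?M ({f. f None} \<union> {f. n < 2 * card {i. i < n \<and> Some i \<in> ?H f}})"
    unfolding percolation_prob_def by (rule measure_pmf.finite_measure_mono) simp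
  also have "\<dots> \<le> measure_pmf.prob ?M {f. f None} +
      measure_pmf.prob ?M {f. n < 2 * card {i. i < n \<and> Some i \<in> ?H f}}"
    by (rule measure_Un_le) auto
  also have "measure_pmf.prob ?M {f. f None} = p"
    by (rule prob_active[OF finite_verts_wheel _ p]) (simp add: verts_wheel)
  also have "measure_pmf.prob ?M {f. n < 2 * card {i. i < n \<and> Some i \<in> ?H f}} \<le>
    2 * (p + 2 * (1 - (1 - p) ^ (r + 1)) ^ m + (2 * real m * (real r + 1) + 1) * (4 * p * (1 - p)) ^ r)"
  proof (rule prob_majority_le[OF n(1)])
    fix i assume "i < n"
    then show "measure_pmf.prob ?M {f. Some i \<in> ?H f} \<le>
        p + 2 * (1 - (1 - p) ^ (r + 1)) ^ m + (2 * real m * (real r + 1) + 1) * (4 * p * (1 - p)) ^ r"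
      using prob_in_ring_hull_le[OF assms, of "int i"] by (simp add: pos_of_nat)
  qed
  finally show ?thesis by simp
qed

section \<open>Choice of the number of blocks below 1/4\<close>

lemma exp_minus_6_le: "exp (- 6) \<le> (1 / 64 :: real)"
proof -
  have "(2 :: real) ^ 6 \<le> exp 1 ^ 6"
    using exp_ge_add_one_self[of "1 :: real"] by (intro power_mono) auto
  also have "exp 1 ^ 6 = exp (6 :: real)"
    by (simp flip: exp_of_nat_mult)
  finally show ?thesis by (simp add: exp_minus field_simps)
qed

lemma power_one_minus_le_exp:
  assumes "0 \<le> (q :: real)" "q \<le> 1"
  shows "(1 - q) ^ m \<le> exp (- (real m * q))"
proof -
  have "(1 - q) ^ m \<le> exp (- q) ^ m"
    using assms exp_ge_add_one_self[of "- q"] by (intro power_mono) auto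
  also have "\<dots> = exp (- (real m * q))"
    by (simp flip: exp_of_nat_mult)
  finally show ?thesis .
qed

text \<open>With about \<open>6 / q\<close> blocks a passive one is missing on a side with
  probability at most \<open>exp (- 6)\<close>. The price is a union over order
  \<open>(r + 1) / q\<close> positions, and \<open>1 / q\<close> cancels the factor
  \<open>(1-p)^r\<close> of the majority probability, so that \<open>(4 p)^r\<close>
  decides.\<close>

lemma percolation_prob_wheel_subcritical:
  fixes p e :: real
  assumes p: "0 \<le> p" "p \<le> 1 / 4 - e" and e: "0 < e"
    and small: "(real r + 1) * (1 - 4 * e) ^ r \<le> 1 / 640"
  shows "\<exists>N. \<forall>n\<ge>N. percolation_prob (wheel r n) p \<le> 7 / 8"
proof -
  define q where "q = (1 - p) ^ (r + 1)"
  define m where "m = nat \<lceil>6 / q\<rceil>"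
  have p': "p \<le> 1 / 4" using p e by simp
  have q: "0 < q" "q \<le> 1" using p p' unfolding q_def by (simp, intro power_le_one) auto
  have m: "6 / q \<le> real m" "real m \<le> 6 / q + 1"
    using q by (auto simp: m_def of_nat_ceiling)
  have t1: "(1 - q) ^ m \<le> 1 / 64"
  proof -
    have "(1 - q) ^ m \<le> exp (- (real m * q))"
      using q by (intro power_one_minus_le_exp) auto
    also have "\<dots> \<le> exp (- 6)" using m(1) q by (simp add: field_simps)
    finally show ?thesis using exp_minus_6_le by linarith
  qed
  have t2: "(2 * real m * (real r + 1) + 1) * (4 * p * (1 - p)) ^ r \<le> 1 / 32"
  proof -
    have "real m \<le> 7 / q" using m(2) q by (simp add: field_simps)
    then have "2 * real m * (real r + 1) + 1 \<le> 2 * (7 / q) * (real r + 1) + 1 / q * (real r + 1)"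
      using q by (intro add_mono mult_right_mono mult_left_mono) (auto simp: field_simps)
    also have "\<dots> = 15 / q * (real r + 1)" using q by (simp add: field_simps)
    finally have "(2 * real m * (real r + 1) + 1) * (4 * p * (1 - p)) ^ r \<le>
        15 / q * (real r + 1) * (4 * p * (1 - p)) ^ r"
      using p p' by (intro mult_right_mono) auto
    \<comment> \<open>\<open>q\<close> is \<open>(1 - p) ^ (r + 1)\<close>, so one factor
      \<open>1 / (1 - p)\<close> survives; it is at most 4/3, which yields the constant 20, and
      \<open>20 / 640 = 1 / 32\<close>.\<close>
    also have "\<dots> = 15 / (1 - p) * ((real r + 1) * (4 * p) ^ r)"
    proof -
      have "(4 * p * (1 - p)) ^ r = (4 * p) ^ r * (1 - p) ^ r" by (rule power_mult_distrib)
      moreover have "(1 - p) ^ r \<noteq> 0" using p' by simp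
      ultimately show ?thesis by (simp add: q_def)
    qed
    also have "\<dots> \<le> 20 * ((real r + 1) * (1 - 4 * e) ^ r)"
      using p p' by (intro mult_mono mult_left_mono power_mono) (auto simp: field_simps)
    also have "\<dots> \<le> 1 / 32" using small by simp
    finally show ?thesis .
  qed
  \<comment> \<open>The total is at most
    \<open>p + 2 * (p + 2 / 64 + 1 / 32) = 3 * p + 1 / 8\<close>, and
    \<open>p \<le> 1 / 4\<close>.\<close>
  have "percolation_prob (wheel r n) p \<le> 7 / 8" if "2 * (m * (r + 1)) + 2 * r + 1 \<le> n" for n
    using percolation_prob_wheel_le[of m r n p] that t1 t2 p p' unfolding q_def by simp
  then show ?thesis by blast
qed

lemma liminf_percolation_prob_wheel_neq_1:
  fixes p e :: real
  assumes "0 \<le> p" "p \<le> 1 / 4 - e" "0 < e" "(real r + 1) * (1 - 4 * e) ^ r \<le> 1 / 640"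
  shows "liminf (\<lambda>n. ereal (percolation_prob (wheel r n) p)) \<noteq> 1"
proof -
  obtain N where N: "\<forall>n\<ge>N. percolation_prob (wheel r n) p \<le> 7 / 8"
    using percolation_prob_wheel_subcritical[OF assms] by blast
  have "limsup (\<lambda>n. ereal (percolation_prob (wheel r n) p)) \<le> ereal (7 / 8)"
    by (rule Limsup_bounded) (use N in \<open>auto simp: eventually_sequentially\<close>)
  then have "liminf (\<lambda>n. ereal (percolation_prob (wheel r n) p)) \<le> ereal (7 / 8)"
    using Liminf_le_Limsup[OF sequentially_bot] order_trans by blast
  also have "ereal (7 / 8) < 1" by simp
  finally show ?thesis by simp
qed

lemma eventually_succ_mult_power_le:
  assumes "0 < e" "e < 1 / 4"
  shows "\<forall>\<^sub>F r in sequentially. (real r + 1) * (1 - 4 * e) ^ r \<le> 1 / 640"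
proof -
  have "(\<lambda>r. real r * (1 - 4 * e) ^ r + (1 - 4 * e) ^ r) \<longlonglongrightarrow> 0 + 0"
    using assms by (intro tendsto_add powser_times_n_limit_0 LIMSEQ_power_zero) auto
  then have "(\<lambda>r. (real r + 1) * (1 - 4 * e) ^ r) \<longlonglongrightarrow> 0"
    by (simp add: algebra_simps)
  then have "\<forall>\<^sub>F r in sequentially. (real r + 1) * (1 - 4 * e) ^ r < 1 / 640"
    by (rule order_tendstoD) simp
  then show ?thesis by eventually_elim simp
qed

subsection \<open>Above \<open>1/4\<close>: nucleation and growth\<close>

lemma nhd_split: "nhd r z = {z - int r..<z} \<union> {z + 1..<z + 1 + int r}"
  by (auto simp: nhd_def)

text \<open>The \<open>r\<close> active vertices on the left are one short of the threshold
  \<open>r + 1\<close>; any active vertex among the next \<open>r\<close> on the right supplies the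
  missing one. Hence only passive runs can stop growth.\<close>

lemma final_active_wheel_right:
  assumes "2 * r < n" "\<And>y. y \<in> {z - int r..<z} \<Longrightarrow> pos n y \<in> final_active (wheel r n) A"
    and "\<exists>y\<in>{z + 1..<z + 1 + int r}. pos n y \<in> final_active (wheel r n) A"
  shows "pos n z \<in> final_active (wheel r n) A"
proof -
  obtain y where y: "y \<in> {z + 1..<z + 1 + int r}" "pos n y \<in> final_active (wheel r n) A"
    using assms(3) by blast
  have "card (insert y {z - int r..<z}) \<le> card {y \<in> nhd r z. pos n y \<in> final_active (wheel r n) A}"
    using assms(2) y by (intro card_mono) (auto simp: nhd_split)
  then show ?thesis
    using y(1) by (intro final_active_wheel_posI[OF assms(1)]) simp
qed

lemma final_active_wheel_left:
  assumes "2 * r < n" "\<And>y. y \<in> {z + 1..<z + 1 + int r} \<Longrightarrow> pos n y \<in> final_active (wheel r n) A"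
    and "\<exists>y\<in>{z - int r..<z}. pos n y \<in> final_active (wheel r n) A"
  shows "pos n z \<in> final_active (wheel r n) A"
proof -
  obtain y where y: "y \<in> {z - int r..<z}" "pos n y \<in> final_active (wheel r n) A"
    using assms(3) by blast
  have "card (insert y {z + 1..<z + 1 + int r}) \<le> card {y \<in> nhd r z. pos n y \<in> final_active (wheel r n) A}"
    using assms(2) y by (intro card_mono) (auto simp: nhd_split)
  then show ?thesis
    using y(1) by (intro final_active_wheel_posI[OF assms(1)]) simp
qed

text \<open>Here the hub supplies the missing neighbour, so growth can no longer be stopped.\<close>

lemma final_active_wheel_hub:
  assumes "2 * r < n" "\<And>y. y \<in> {z - int r..<z} \<Longrightarrow> pos n y \<in> final_active (wheel r n) A"
    and "None \<in> final_active (wheel r n) A"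
  shows "pos n z \<in> final_active (wheel r n) A"
proof -
  have "card {z - int r..<z} \<le> card {y \<in> nhd r z. pos n y \<in> final_active (wheel r n) A}"
    using assms(2) by (intro card_mono) (auto simp: nhd_split)
  then show ?thesis
    using assms(3) by (intro final_active_wheel_posI[OF assms(1)]) simp
qed

lemma interval_extend_right:
  fixes P :: "int \<Rightarrow> bool"
  assumes base: "\<And>y. y \<in> {a..<a + int r} \<Longrightarrow> P y"
    and step: "\<And>z. a + int r \<le> z \<Longrightarrow> z < u \<Longrightarrow> (\<And>y. y \<in> {z - int r..<z} \<Longrightarrow> P y) \<Longrightarrow> P z"
    and z: "a \<le> z" "z < u"
  shows "P z"
proof -
  have "a + int i < u \<Longrightarrow> P (a + int i)" for i
  proof (induction i rule: less_induct)
    case (less i)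
    show ?case
    proof (cases "i < r")
      case False
      show ?thesis
      proof (rule step)
        fix y assume y: "y \<in> {a + int i - int r..<a + int i}"
        then have "P (a + int (nat (y - a)))"
          using False less.prems by (intro less.IH) auto
        then show "P y" using y False by simp
      qed (use False less.prems in auto)
    qed (simp add: base)
  qed
  from this[of "nat (z - a)"] show ?thesis using z by simp
qed

lemma interval_extend_left:
  fixes P :: "int \<Rightarrow> bool"
  assumes base: "\<And>y. y \<in> {a..<a + int r} \<Longrightarrow> P y"
    and step: "\<And>z. l \<le> z \<Longrightarrow> z < a \<Longrightarrow> (\<And>y. y \<in> {z + 1..<z + 1 + int r} \<Longrightarrow> P y) \<Longrightarrow> P z"
    and z: "l \<le> z" "z < a + int r"
  shows "P z"
proof -
  define Q where "Q = (\<lambda>z. P (- z))"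
  \<comment> \<open>Reflection sends \<open>{a..<a + r}\<close> to
    \<open>{1 - a - r..<1 - a}\<close> and the bound \<open>l \<le> z\<close> to
    \<open>- z < 1 - l\<close>; the shifts by 1 come from half-open intervals.\<close>
  have "Q (- z)"
  proof (rule interval_extend_right[where a = "1 - a - int r" and r = r and u = "1 - l"])
    show "Q y" if "y \<in> {1 - a - int r..<1 - a - int r + int r}" for y
      using that unfolding Q_def by (intro base) auto
    show "Q t" if "1 - a - int r + int r \<le> t" "t < 1 - l"
      and IH: "\<And>y. y \<in> {t - int r..<t} \<Longrightarrow> Q y" for t
      unfolding Q_def
    proof (rule step)
      fix y assume "y \<in> {- t + 1..<- t + 1 + int r}"
      then have "Q (- y)" by (intro IH) auto
      then show "P y" by (simp add: Q_def)
    qed (use that in auto)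
  qed (use z in auto)
  then show ?thesis by (simp add: Q_def)
qed

text \<open>A full interval of length \<open>r\<close> grows in both directions. It stops
  \<open>r\<close> short of each end because active vertices are guaranteed only in windows inside
  the segment.\<close>

lemma segment_fills:
  assumes "2 * r < n" "l \<le> a" "a + int r \<le> u"
    and full: "\<And>y. y \<in> {a..<a + int r} \<Longrightarrow> pos n y \<in> final_active (wheel r n) A"
    and hit: "\<And>y. l \<le> y \<Longrightarrow> y + int r \<le> u \<Longrightarrow> \<exists>z\<in>{y..<y + int r}. pos n z \<in> A"
    and z: "l + int r \<le> z" "z < u - int r"
  shows "pos n z \<in> final_active (wheel r n) A"
proof (cases "a \<le> z")
  case True
  show ?thesis
  proof (rule interval_extend_right[where P = "\<lambda>y. pos n y \<in> final_active (wheel r n) A", OF full])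
    fix t assume "a + int r \<le> t" "t < u - int r"
      and *: "\<And>y. y \<in> {t - int r..<t} \<Longrightarrow> pos n y \<in> final_active (wheel r n) A"
    then have "\<exists>y\<in>{t + 1..<t + 1 + int r}. pos n y \<in> final_active (wheel r n) A"
      using hit[of "t + 1"] assms(2) subset_final_active[of A "wheel r n"] by fastforce
    with * show "pos n t \<in> final_active (wheel r n) A"
      by (rule final_active_wheel_right[OF assms(1)])
  qed (use True z in auto)
next
  case False
  show ?thesis
  proof (rule interval_extend_left[where P = "\<lambda>y. pos n y \<in> final_active (wheel r n) A", OF full])
    fix t assume "l + int r \<le> t" "t < a"
      and *: "\<And>y. y \<in> {t + 1..<t + 1 + int r} \<Longrightarrow> pos n y \<in> final_active (wheel r n) A"
    then have "\<exists>y\<in>{t - int r..<t}. pos n y \<in> final_active (wheel r n) A"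
      using hit[of "t - int r"] assms(3) subset_final_active[of A "wheel r n"] by fastforce
    with * show "pos n t \<in> final_active (wheel r n) A"
      by (rule final_active_wheel_left[OF assms(1)])
  qed (use False z in auto)
qed

text \<open>Growth to the right suffices: on the ring every vertex has representatives beyond
  \<open>a\<close>, reached by adding whole turns.\<close>

lemma hub_fills:
  assumes "2 * r < n" "None \<in> final_active (wheel r n) A"
    and full: "\<And>y. y \<in> {a..<a + int r} \<Longrightarrow> pos n y \<in> final_active (wheel r n) A"
  shows "percolates (wheel r n) A"
proof -
  have *: "pos n z \<in> final_active (wheel r n) A" if "a \<le> z" for z
  proof (rule interval_extend_right[where P = "\<lambda>y. pos n y \<in> final_active (wheel r n) A", OF full])
    show "pos n t \<in> final_active (wheel r n) A"
      if "\<And>y. y \<in> {t - int r..<t} \<Longrightarrow> pos n y \<in> final_active (wheel r n) A" for t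
      using that by (rule final_active_wheel_hub[OF assms(1) _ assms(2)])
    show "z < z + 1" by simp
  qed (use that in auto)
  have "Some i \<in> final_active (wheel r n) A" if "i < n" for i
  proof -
    have "a \<le> \<bar>a\<bar> * 1" by simp
    also have "\<dots> \<le> \<bar>a\<bar> * int n" using that by (intro mult_left_mono) auto
    finally have "pos n (int i + \<bar>a\<bar> * int n) \<in> final_active (wheel r n) A"
      by (intro *) simp
    then show ?thesis using that by (simp add: pos_of_nat)
  qed
  then show ?thesis
    using assms(2) by (auto simp: percolates_iff verts_wheel)
qed

section \<open>Counting in integer intervals and the density of cells\<close>

lemma finite_filter_int_interval [simp]: "finite {y :: int. a \<le> y \<and> y < b \<and> P y}"
  by (rule finite_subset[of _ "{a..<b}"]) auto

text \<open>Half-open intervals make counts over adjacent intervals add up, and integer values allow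
  subtraction in the density estimates.\<close>

definition cnt :: "(int \<Rightarrow> bool) \<Rightarrow> int \<Rightarrow> int \<Rightarrow> int" where
  "cnt P a b = int (card {y \<in> {a..<b}. P y})"

lemma cnt_nonneg: "0 \<le> cnt P a b"
  by (simp add: cnt_def)

lemma cnt_add:
  assumes "a \<le> b" "b \<le> c"
  shows "cnt P a c = cnt P a b + cnt P b c"
proof -
  have "{y \<in> {a..<c}. P y} = {y \<in> {a..<b}. P y} \<union> {y \<in> {b..<c}. P y}"
    using assms by auto
  moreover have "card ({y \<in> {a..<b}. P y} \<union> {y \<in> {b..<c}. P y}) =
      card {y \<in> {a..<b}. P y} + card {y \<in> {b..<c}. P y}"
    by (rule card_Un_disjoint) auto
  ultimately show ?thesis
    unfolding cnt_def by presburger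
qed

lemma cnt_mono: "a' \<le> a \<Longrightarrow> b \<le> b' \<Longrightarrow> cnt P a b \<le> cnt P a' b'"
  unfolding cnt_def by (intro of_nat_mono card_mono) auto

lemma cnt_full:
  assumes "\<And>y. y \<in> {a..<b} \<Longrightarrow> P y" "a \<le> b"
  shows "cnt P a b = b - a"
proof -
  have "{y \<in> {a..<b}. P y} = {a..<b}" using assms by auto
  then show ?thesis using assms(2) by (simp add: cnt_def)
qed

lemma cnt_cells:
  fixes s :: int and w c d :: nat
  assumes cells: "\<And>i. i < w \<Longrightarrow> int c \<le> cnt P (s + int d * int i) (s + int d * int i + int d)"
    and "i0 \<le> i1" "i1 \<le> w"
  shows "int c * (int i1 - int i0) \<le> cnt P (s + int d * int i0) (s + int d * int i1)"
  using assms(2,3)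
proof (induction rule: dec_induct)
  case (step i)
  have "int d * int i0 \<le> int d * int i" using step.hyps by (intro mult_left_mono) auto
  then have "cnt P (s + int d * int i0) (s + int d * int (Suc i)) =
      cnt P (s + int d * int i0) (s + int d * int i) + cnt P (s + int d * int i) (s + int d * int (Suc i))"
    by (intro cnt_add) (auto simp: algebra_simps)
  moreover have "int c \<le> cnt P (s + int d * int i) (s + int d * int (Suc i))"
    using cells[of i] step.prems by (simp add: algebra_simps)
  ultimately show ?case
    using step.IH step.prems by (simp add: algebra_simps)
qed (simp add: cnt_nonneg)

text \<open>Cutting \<open>{a..<b}\<close> down to whole cells loses at most one cell length
  \<open>d\<close> at each end. The estimate "density at least \<open>c / d\<close>" is kept free of
  division.\<close>

lemma cnt_density:
  fixes s a b :: int and w c d :: nat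
  assumes cells: "\<And>i. i < w \<Longrightarrow> int c \<le> cnt P (s + int d * int i) (s + int d * int i + int d)"
    and d: "d > 0" and ab: "s \<le> a" "b \<le> s + int d * int w"
  shows "int c * (b - a - 2 * int d) \<le> int d * cnt P a b"
proof (cases "b - a \<le> 2 * int d")
  case True
  then have "int c * (b - a - 2 * int d) \<le> 0" by (simp add: mult_nonneg_nonpos)
  also have "0 \<le> int d * cnt P a b" by (simp add: cnt_nonneg)
  finally show ?thesis .
next
  case False
  \<comment> \<open>Even if \<open>a\<close> is a cell boundary, \<open>i0\<close> is the next cell;
    this still loses at most \<open>d\<close>.\<close>
  define i0 where "i0 = nat ((a - s) div int d) + 1"
  define i1 where "i1 = nat ((b - s) div int d)"
  have i0: "int i0 = (a - s) div int d + 1" and i1: "int i1 = (b - s) div int d"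
    using ab d False by (simp_all add: i0_def i1_def pos_imp_zdiv_nonneg_iff)
  have div_bounds: "int d * (x div int d) \<le> x" "x < int d * (x div int d) + int d" for x
    using d pos_mod_bound[of "int d" x] pos_mod_sign[of "int d" x]
    unfolding minus_mod_eq_mult_div[symmetric] by simp_all
  have i0': "int d * int i0 = int d * ((a - s) div int d) + int d"
    by (simp add: i0 distrib_left)
  have bounds: "a - s \<le> int d * int i0" "int d * int i0 \<le> a - s + int d"
    "int d * int i1 \<le> b - s" "b - s - int d \<le> int d * int i1"
    using div_bounds[of "a - s"] div_bounds[of "b - s"] i0' unfolding i1 by simp_all
  have "int d * int i0 \<le> int d * int i1" using bounds False by linarith
  then have "i0 \<le> i1" using d by simp
  have "int d * int i1 \<le> int d * int w" using bounds ab by linarith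
  then have "i1 \<le> w" using d by simp
  have "int c * (b - a - 2 * int d) \<le> int c * (int d * (int i1 - int i0))"
    using bounds by (intro mult_left_mono) (auto simp: right_diff_distrib)
  also have "\<dots> = int d * (int c * (int i1 - int i0))" by simp
  also have "\<dots> \<le> int d * cnt P (s + int d * int i0) (s + int d * int i1)"
    using cnt_cells[OF cells \<open>i0 \<le> i1\<close> \<open>i1 \<le> w\<close>] by (intro mult_left_mono) auto
  also have "\<dots> \<le> int d * cnt P a b"
    using bounds by (intro mult_left_mono cnt_mono) auto
  finally show ?thesis .
qed

lemma final_active_wheel_cntI:
  assumes "2 * r < n"
    and "int r + 1 \<le> cnt (\<lambda>y. pos n y \<in> final_active (wheel r n) A) (z - int r) z
      + cnt (\<lambda>y. pos n y \<in> final_active (wheel r n) A) (z + 1) (z + 1 + int r)"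
  shows "pos n z \<in> final_active (wheel r n) A"
proof (rule final_active_wheel_posI[OF assms(1)])
  let ?F = "final_active (wheel r n) A"
  have "{y \<in> nhd r z. pos n y \<in> ?F} =
      {y \<in> {z - int r..<z}. pos n y \<in> ?F} \<union> {y \<in> {z + 1..<z + 1 + int r}. pos n y \<in> ?F}"
    by (auto simp: nhd_split)
  moreover have "card ({y \<in> {z - int r..<z}. pos n y \<in> ?F} \<union> {y \<in> {z + 1..<z + 1 + int r}. pos n y \<in> ?F}) =
      card {y \<in> {z - int r..<z}. pos n y \<in> ?F} + card {y \<in> {z + 1..<z + 1 + int r}. pos n y \<in> ?F}"
    by (rule card_Un_disjoint) auto
  ultimately have "int (card {y \<in> nhd r z. pos n y \<in> ?F}) =
      cnt (\<lambda>y. pos n y \<in> ?F) (z - int r) z + cnt (\<lambda>y. pos n y \<in> ?F) (z + 1) (z + 1 + int r)"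
    unfolding cnt_def by presburger
  then show "r + 1 \<le> card {y \<in> nhd r z. pos n y \<in> ?F} + (if None \<in> ?F then 1 else 0)"
    using assms(2) by linarith
qed

text \<open>
  A stretch of cells of constant length \<open>2 k\<close>, each with at least \<open>k + 1\<close> active vertices, has density
  \<open>1/2 + 1/(2 k)\<close>. For large \<open>r\<close> the surplus \<open>r/k\<close> beats all boundary effects at the centre \<open>c\<close>, and
  when \<open>{c - j..<c + j}\<close> is full, moving the window by \<open>j\<close> loses fewer vertices than have been gained.
  The activation is only followed until the full interval has length \<open>r\<close>.
\<close>

lemma nucleation:
  assumes n: "2 * r < n" and k: "3 \<le> k" and r: "(k + 1) * (8 * k + 1) + 2 * k \<le> r" and w: "r \<le> k * w"
    and cells: "\<And>i. i < w \<Longrightarrow>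
      int (k + 1) \<le> cnt (\<lambda>y. pos n y \<in> A) (s + int (2 * k) * int i) (s + int (2 * k) * int i + int (2 * k))"
  shows "\<exists>a. s \<le> a \<and> a + int r \<le> s + int (2 * k) * int w \<and>
    (\<forall>y\<in>{a..<a + int r}. pos n y \<in> final_active (wheel r n) A)"
proof -
  let ?F = "final_active (wheel r n) A"
  let ?c = "cnt (\<lambda>y. pos n y \<in> ?F)"
  \<comment> \<open>\<open>c\<close> is the centre of the stretch and \<open>h\<close>, at least
    \<open>r\<close>, its half length, so positions within distance \<open>r\<close> of
    \<open>c\<close> are covered by cells.\<close>
  define h where "h = int k * int w"
  define c where "c = s + h"
  have h: "int r \<le> h" using w unfolding h_def by (metis of_nat_le_iff of_nat_mult)
  have cells': "int (k + 1) \<le> ?c (s + int (2 * k) * int i) (s + int (2 * k) * int i + int (2 * k))" if "i < w" for i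
  proof -
    have "cnt (\<lambda>y. pos n y \<in> A) a b \<le> ?c a b" for a b
      unfolding cnt_def using subset_final_active[of A "wheel r n"]
      by (intro of_nat_mono card_mono) auto
    then show ?thesis using cells[OF that] order_trans by blast
  qed
  have dens: "(int k + 1) * (b - a - 4 * int k) \<le> 2 * int k * ?c a b"
    if "c - h \<le> a" "b \<le> c + h" for a b
    using cnt_density[where P = "\<lambda>y. pos n y \<in> ?F" and a = a and b = b, OF cells'] that k
    by (simp add: c_def h_def algebra_simps)
  have r': "(int k + 1) * (8 * int k + 1) + 2 * int k \<le> int r"
  proof -
    have "int ((k + 1) * (8 * k + 1) + 2 * k) \<le> int r"
      using r by (simp only: of_nat_le_iff)
    then show ?thesis by (simp add: algebra_simps)
  qed
  have "0 \<le> (int k + 1) * (8 * int k + 1)" by simp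
  then have rpos: "2 \<le> int r" using r' k by linarith
  \<comment> \<open>The window of a vertex next to the full interval of length \<open>2 j\<close>
    has partly filled pieces of lengths \<open>r - 2 j\<close> and \<open>r - 1 - j\<close>. After
    multiplication by \<open>2 k\<close> the coefficient of \<open>j\<close> is
    \<open>4 k - 3 (k + 1) = k - 3\<close>, whence \<open>3 \<le> k\<close>; the surplus
    \<open>2 r\<close> absorbs \<open>(k + 1) (8 k + 1) + 2 k\<close>.\<close>
  have enough: "int r + 1 \<le> x + y + 2 * int j"
    if x: "(int k + 1) * (int r - 2 * int j - 4 * int k) \<le> 2 * int k * x"
      and y: "(int k + 1) * (int r - 1 - int j - 4 * int k) \<le> 2 * int k * y" for x y j
  proof -
    have "0 \<le> (int k - 3) * int j" using k by simp
    then have "2 * int k * (int r + 1) \<le> 2 * int k * (x + y + 2 * int j)"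
      using x y r' by (simp add: algebra_simps)
    then show ?thesis using k by simp
  qed
  have grow: "2 * j \<le> r + 1 \<Longrightarrow> y \<in> {c - int j..<c + int j} \<Longrightarrow> pos n y \<in> ?F" for j y
  proof (induction j arbitrary: y)
    case (Suc j)
    have j: "2 * int j \<le> int r - 1" using Suc.prems(1) by simp
    have IH: "?c (c - int j) (c + int j) = 2 * int j"
      using Suc.IH j by (subst cnt_full) auto
    have "pos n (c + int j) \<in> ?F"
    proof (rule final_active_wheel_cntI[OF n])
      \<comment> \<open>The right half of the window is truncated at \<open>c + r\<close>, since
        beyond it the stretch of cells may have ended.\<close>
      have "int r + 1 \<le> ?c (c + int j - int r) (c - int j) + ?c (c + int j + 1) (c + int r) + 2 * int j"
        using dens[of "c + int j - int r" "c - int j"] dens[of "c + int j + 1" "c + int r"] j h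
        by (intro enough) (auto simp: algebra_simps)
      moreover have "?c (c + int j - int r) (c + int j) = ?c (c + int j - int r) (c - int j) + 2 * int j"
        using cnt_add[of "c + int j - int r" "c - int j" "c + int j" "\<lambda>y. pos n y \<in> ?F"] j IH by simp
      moreover have "?c (c + int j + 1) (c + int r) \<le> ?c (c + int j + 1) (c + int j + 1 + int r)"
        by (rule cnt_mono) auto
      ultimately show "int r + 1 \<le> ?c (c + int j - int r) (c + int j) + ?c (c + int j + 1) (c + int j + 1 + int r)"
        by linarith
    qed
    moreover have "pos n (c - int j - 1) \<in> ?F"
    proof (rule final_active_wheel_cntI[OF n])
      have "int r + 1 \<le> ?c (c + int j) (c - int j + int r) + ?c (c - int r) (c - int j - 1) + 2 * int j"
        using dens[of "c + int j" "c - int j + int r"] dens[of "c - int r" "c - int j - 1"] j h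
        by (intro enough) (auto simp: algebra_simps)
      moreover have "?c (c - int j) (c - int j + int r) = 2 * int j + ?c (c + int j) (c - int j + int r)"
        using cnt_add[of "c - int j" "c + int j" "c - int j + int r" "\<lambda>y. pos n y \<in> ?F"] j IH by simp
      moreover have "?c (c - int r) (c - int j - 1) \<le> ?c (c - int j - 1 - int r) (c - int j - 1)"
        by (rule cnt_mono) auto
      ultimately show "int r + 1 \<le> ?c (c - int j - 1 - int r) (c - int j - 1) +
          ?c (c - int j - 1 + 1) (c - int j - 1 + 1 + int r)"
        by simp
    qed
    moreover have "y \<in> {c - int j..<c + int j} \<or> y = c + int j \<or> y = c - int j - 1"
      using Suc.prems(2) by auto
    ultimately show ?case using Suc.IH[of y] Suc.prems(1) by auto
  qed simp
  \<comment> \<open>The smallest \<open>j\<close> with \<open>2 j \<ge> r\<close>; it is still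
    within the range \<open>2 j \<le> r + 1\<close> of \<open>grow\<close>.\<close>
  define j where "j = (r + 1) div 2"
  have j: "2 * j \<le> r + 1" "r \<le> 2 * j" by (auto simp: j_def)
  show ?thesis
  proof (intro exI conjI ballI)
    show "s \<le> c - int j" "c - int j + int r \<le> s + int (2 * k) * int w"
      using j h rpos by (auto simp: c_def h_def)
    fix y assume "y \<in> {c - int j..<c - int j + int r}"
    then have "y \<in> {c - int j..<c + int j}" using j by auto
    then show "pos n y \<in> ?F" by (rule grow[OF j(1)])
  qed
qed

text \<open>
  A segment consists of \<open>u\<close> regions of \<open>w\<close> cells. It is good if none of its windows of length \<open>r\<close> is
  passive (so growth is not blocked) and some region has only dense cells (so growth starts).
\<close>

definition good_segment :: "nat \<Rightarrow> nat \<Rightarrow> nat \<Rightarrow> nat \<Rightarrow> nat \<Rightarrow> int \<Rightarrow> (nat option \<Rightarrow> bool) \<Rightarrow> bool" where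
  "good_segment n r k w u s f \<longleftrightarrow>
     (\<forall>y. s \<le> y \<and> y + int r \<le> s + int (2 * k * w * u) \<longrightarrow> (\<exists>v\<in>pos n ` {y..<y + int r}. f v)) \<and>
     (\<exists>j<u. \<forall>i<w. k + 1 \<le> card {v \<in> pos n ` {s + int (2 * k * w) * int j + int (2 * k) * int i
        ..<s + int (2 * k * w) * int j + int (2 * k) * int i + int (2 * k)}. f v})"

lemma good_segmentD:
  assumes n: "2 * r < n" and k: "3 \<le> k" and r: "(k + 1) * (8 * k + 1) + 2 * k \<le> r" and w: "r \<le> k * w"
    and good: "good_segment n r k w u s f"
  defines "F \<equiv> final_active (wheel r n) {v \<in> verts (wheel r n). f v}"
  shows "\<exists>a. \<forall>y\<in>{a..<a + int r}. pos n y \<in> F"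
    and "\<And>z. s + int r \<le> z \<Longrightarrow> z < s + int (2 * k * w * u) - int r \<Longrightarrow> pos n z \<in> F"
proof -
  let ?A = "{v \<in> verts (wheel r n). f v}"
  have inA: "pos n y \<in> ?A \<longleftrightarrow> f (pos n y)" for y
    using pos_in_verts[of n y] n by (simp add: verts_wheel)
  obtain j where j: "j < u" and cells: "\<And>i. i < w \<Longrightarrow>
      k + 1 \<le> card {v \<in> pos n ` {s + int (2 * k * w) * int j + int (2 * k) * int i
        ..<s + int (2 * k * w) * int j + int (2 * k) * int i + int (2 * k)}. f v}"
    using good unfolding good_segment_def by blast
  define t where "t = s + int (2 * k * w) * int j"
  have card_le: "int (card {v \<in> pos n ` {a..<b}. f v}) \<le> cnt (\<lambda>y. pos n y \<in> ?A) a b" for a b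
  proof -
    have "{v \<in> pos n ` {a..<b}. f v} = pos n ` {y \<in> {a..<b}. pos n y \<in> ?A}"
      using inA by auto
    then show ?thesis unfolding cnt_def by (simp add: card_image_le)
  qed
  have "\<exists>a. t \<le> a \<and> a + int r \<le> t + int (2 * k) * int w \<and> (\<forall>y\<in>{a..<a + int r}. pos n y \<in> F)"
    unfolding F_def
  proof (rule nucleation[OF n k r w])
    fix i assume "i < w"
    from cells[OF this] have "int (k + 1) \<le> int (card {v \<in> pos n ` {t + int (2 * k) * int i
        ..<t + int (2 * k) * int i + int (2 * k)}. f v})"
      unfolding t_def by (simp only: of_nat_le_iff)
    also note card_le
    finally show "int (k + 1) \<le> cnt (\<lambda>y. pos n y \<in> ?A) (t + int (2 * k) * int i) (t + int (2 * k) * int i + int (2 * k))" .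
  qed
  then obtain a where a: "t \<le> a" "a + int r \<le> t + int (2 * k) * int w" "\<And>y. y \<in> {a..<a + int r} \<Longrightarrow> pos n y \<in> F"
    by blast
  then show "\<exists>a. \<forall>y\<in>{a..<a + int r}. pos n y \<in> F" by blast
  have "Suc j * (2 * k * w) \<le> u * (2 * k * w)" using j by (intro mult_right_mono) auto
  then have "int (Suc j * (2 * k * w)) \<le> int (u * (2 * k * w))" by (simp only: of_nat_le_iff)
  then have tu: "t + int (2 * k) * int w \<le> s + int (2 * k * w * u)"
    by (simp add: t_def algebra_simps)
  have st: "s \<le> t" by (simp add: t_def)
  show "pos n z \<in> F" if "s + int r \<le> z" "z < s + int (2 * k * w * u) - int r" for z
    unfolding F_def
  proof (rule segment_fills[OF n, where a = a and l = s and u = "s + int (2 * k * w * u)"])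
    show "\<exists>z\<in>{y..<y + int r}. pos n z \<in> ?A" if "s \<le> y" "y + int r \<le> s + int (2 * k * w * u)" for y
      using good that inA unfolding good_segment_def by blast
    show "pos n y \<in> final_active (wheel r n) ?A" if "y \<in> {a..<a + int r}" for y
      using a(3)[OF that] by (simp add: F_def)
  qed (use a tu st that in auto)
qed

text \<open>Each good segment activates all but \<open>2 r\<close> of its \<open>M\<close> vertices.
  Once these exceed half of the ring the hub follows, and a full interval in any good segment then
  sweeps round the ring.\<close>

lemma percolates_if_many_good:
  assumes n: "2 * r < n" and k: "3 \<le> k" and r: "(k + 1) * (8 * k + 1) + 2 * k \<le> r" and w: "r \<le> k * w"
    and M: "M = 2 * k * w * u" "K * M \<le> n"
    and G: "G \<subseteq> {..<K}" "\<And>i. i \<in> G \<Longrightarrow> good_segment n r k w u (int i * int M) f"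
    and many: "n + 1 \<le> 2 * (card G * (M - 2 * r))"
  shows "percolates (wheel r n) {v \<in> verts (wheel r n). f v}"
proof -
  let ?F = "final_active (wheel r n) {v \<in> verts (wheel r n). f v}"
  let ?I = "\<lambda>i. {i * M + r..<i * M + M - r}"
  have fin: "finite G" using G(1) finite_subset by blast
  have "(\<Union>i\<in>G. ?I i) \<subseteq> {i. i < n \<and> Some i \<in> ?F}"
  proof
    fix z assume "z \<in> (\<Union>i\<in>G. ?I i)"
    then obtain i where i: "i \<in> G" "i * M + r \<le> z" "z < i * M + M - r" by auto
    have "Suc i * M \<le> K * M" using i(1) G(1) by (intro mult_right_mono) auto
    then have z: "z < n" using i M(2) by simp
    have *: "int i * int M = int (i * M)" by simp
    have "pos n (int z) \<in> ?F"
    proof (rule good_segmentD(2)[OF n k r w G(2)[OF i(1)]])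
      show "int i * int M + int r \<le> int z" using i(2) unfolding * by linarith
      show "int z < int i * int M + int (2 * k * w * u) - int r"
        using i(3) unfolding * M(1)[symmetric] by linarith
    qed
    then show "z \<in> {i. i < n \<and> Some i \<in> ?F}" using z by (simp add: pos_of_nat)
  qed
  then have "card (\<Union>i\<in>G. ?I i) \<le> card {i. i < n \<and> Some i \<in> ?F}"
    by (intro card_mono) auto
  moreover have "card (\<Union>i\<in>G. ?I i) = (\<Sum>i\<in>G. card (?I i))"
  proof (rule card_UN_disjoint[OF fin])
    have *: "?I i \<inter> ?I j = {}" if "i < j" for i j
    proof -
      have "Suc i * M \<le> j * M" using that by (intro mult_right_mono) auto
      then show ?thesis by auto
    qed
    show "\<forall>i\<in>G. \<forall>j\<in>G. i \<noteq> j \<longrightarrow> ?I i \<inter> ?I j = {}"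
      using * by (metis Int_commute linorder_neqE_nat)
  qed simp
  moreover have "(\<Sum>i\<in>G. card (?I i)) = card G * (M - 2 * r)"
  proof -
    have "card (?I i) = M - 2 * r" for i by (simp add: mult_2)
    then show ?thesis by simp
  qed
  ultimately have "card G * (M - 2 * r) \<le> card {i. i < n \<and> Some i \<in> ?F}"
    by linarith
  then have None: "None \<in> ?F"
    using many by (intro final_active_wheel_NoneI) linarith
  have "G \<noteq> {}" using many by auto
  then obtain i where "i \<in> G" by blast
  then obtain a where "\<forall>y\<in>{a..<a + int r}. pos n y \<in> ?F"
    using good_segmentD(1)[OF n k r w G(2)] by blast
  then show ?thesis by (intro hub_fills[OF n None]) blast
qed

subsection \<open>Above \<open>1/4\<close>: probability of growth\<close>

text \<open>Goodness is decided inside the segment, which makes disjoint segments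
  independent.\<close>

lemma good_segment_cong:
  assumes "\<forall>v\<in>pos n ` {s..<s + int (2 * k * w * u)}. f v = g v"
  shows "good_segment n r k w u s f \<longleftrightarrow> good_segment n r k w u s g"
proof -
  let ?M = "int (2 * k * w * u)"
  let ?C = "\<lambda>j i. pos n ` {s + int (2 * k * w) * int j + int (2 * k) * int i
        ..<s + int (2 * k * w) * int j + int (2 * k) * int i + int (2 * k)}"
  have "(\<exists>v\<in>pos n ` {y..<y + int r}. f v) \<longleftrightarrow> (\<exists>v\<in>pos n ` {y..<y + int r}. g v)"
    if "s \<le> y" "y + int r \<le> s + ?M" for y
  proof (rule bex_cong[OF refl])
    fix v assume "v \<in> pos n ` {y..<y + int r}"
    then have "v \<in> pos n ` {s..<s + ?M}" using that by auto
    with assms show "f v \<longleftrightarrow> g v" by blast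
  qed
  then have hit: "(\<forall>y. s \<le> y \<and> y + int r \<le> s + ?M \<longrightarrow> (\<exists>v\<in>pos n ` {y..<y + int r}. f v)) \<longleftrightarrow>
      (\<forall>y. s \<le> y \<and> y + int r \<le> s + ?M \<longrightarrow> (\<exists>v\<in>pos n ` {y..<y + int r}. g v))"
    by blast
  have "{v \<in> ?C j i. f v} = {v \<in> ?C j i. g v}" if "j < u" "i < w" for j i
  proof (rule Collect_cong, rule conj_cong[OF refl])
    fix v assume v: "v \<in> ?C j i"
    have "int i * int (2 * k) + int (2 * k) \<le> int w * int (2 * k)" by (rule block_subset[OF that(2)])
    moreover have "int j * int (2 * k * w) + int (2 * k * w) \<le> int u * int (2 * k * w)"
      by (rule block_subset[OF that(1)])
    ultimately have "int (2 * k * w) * int j + int (2 * k) * int i + int (2 * k) \<le> ?M"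
      by (simp add: algebra_simps)
    moreover have "0 \<le> int (2 * k * w) * int j + int (2 * k) * int i" by simp
    ultimately have "{s + int (2 * k * w) * int j + int (2 * k) * int i
        ..<s + int (2 * k * w) * int j + int (2 * k) * int i + int (2 * k)} \<subseteq> {s..<s + ?M}"
      unfolding ivl_subset by linarith
    then have "v \<in> pos n ` {s..<s + ?M}" using v by blast
    with assms show "f v \<longleftrightarrow> g v" by blast
  qed
  then have "k + 1 \<le> card {v \<in> ?C j i. f v} \<longleftrightarrow> k + 1 \<le> card {v \<in> ?C j i. g v}" if "j < u" "i < w" for j i
    using that by (simp only:)
  then have "(\<exists>j<u. \<forall>i<w. k + 1 \<le> card {v \<in> ?C j i. f v}) \<longleftrightarrow> (\<exists>j<u. \<forall>i<w. k + 1 \<le> card {v \<in> ?C j i. g v})"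
    by (intro ex_cong1 conj_cong refl all_cong1 imp_cong)
  with hit show ?thesis unfolding good_segment_def by blast
qed

text \<open>Independence at two levels: the \<open>w\<close> disjoint cells of a region are all
  dense with probability at least \<open>q ^ w\<close>, and the \<open>u\<close> disjoint regions
  fail independently.\<close>

lemma prob_no_dense_region_le:
  assumes n: "2 * k * w * u \<le> n" "n > 0" "w > 0" "u > 0" and p: "p \<in> {0..1}"
    and q: "0 \<le> q" "q \<le> measure_pmf.prob (binomial_pmf (2 * k) p) {j. k + 1 \<le> j}"
  shows "measure_pmf.prob (Pi_pmf (verts (wheel r n)) False (\<lambda>_. bernoulli_pmf p))
    {f. \<forall>j\<in>{..<u}. \<not> (\<forall>i\<in>{..<w}. k + 1 \<le> card {v \<in> pos n ` {s + int j * int (2 * k * w) + int i * int (2 * k)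
        ..<s + int j * int (2 * k * w) + int i * int (2 * k) + int (2 * k)}. f v})} \<le> (1 - q ^ w) ^ u"
    (is "measure_pmf.prob ?M {f. \<forall>j\<in>_. \<not> ?R j f} \<le> _")
proof -
  let ?V = "verts (wheel r n)"
  let ?C = "\<lambda>j i. pos n ` {s + int j * int (2 * k * w) + int i * int (2 * k)
        ..<s + int j * int (2 * k * w) + int i * int (2 * k) + int (2 * k)}"
  let ?D = "\<lambda>j. pos n ` {s + int j * int (2 * k * w)..<s + int j * int (2 * k * w) + int (2 * k * w)}"
  have "w * (2 * k) * 1 \<le> w * (2 * k) * u" using n(4) by (intro mult_left_mono) auto
  then have wn: "w * (2 * k) \<le> n" using n(1) by (simp add: algebra_simps)
  have "2 * k * 1 \<le> 2 * k * w" using n(3) by (intro mult_left_mono) auto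
  then have kn: "2 * k \<le> n" using wn by (simp add: algebra_simps)
  have R: "measure_pmf.prob ?M {f. ?R j f} \<ge> q ^ w" for j
  proof -
    have "measure_pmf.prob ?M {f. ?R j f} = (\<Prod>i\<in>{..<w}. measure_pmf.prob ?M {f. k + 1 \<le> card {v \<in> ?C j i. f v}})"
    proof (rule prob_Pi_pmf_disjoint_family[OF finite_verts_wheel])
      show "disjoint_family_on (?C j) {..<w}"
        by (rule disjoint_blocks[OF wn]) auto
      show "?C j i \<subseteq> ?V" for i by (rule pos_image_subset_verts[OF n(2)])
      fix i and f g :: "nat option \<Rightarrow> bool" assume "\<forall>v\<in>?C j i. f v = g v"
      then have "{v \<in> ?C j i. f v} = {v \<in> ?C j i. g v}" by blast
      then show "(k + 1 \<le> card {v \<in> ?C j i. f v}) = (k + 1 \<le> card {v \<in> ?C j i. g v})" by (simp only:)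
    qed simp
    also have "\<dots> = (\<Prod>i\<in>{..<w}. measure_pmf.prob (binomial_pmf (2 * k) p) {j. k + 1 \<le> j})"
    proof (rule prod.cong[OF refl])
      fix i
      show "measure_pmf.prob ?M {f. k + 1 \<le> card {v \<in> ?C j i. f v}} =
          measure_pmf.prob (binomial_pmf (2 * k) p) {j. k + 1 \<le> j}"
        using prob_card_active[OF finite_verts_wheel pos_image_subset_verts[OF n(2)] p, where Q = "\<lambda>m. k + 1 \<le> m"]
        by (simp only: card_block[OF kn])
    qed
    also have "\<dots> = measure_pmf.prob (binomial_pmf (2 * k) p) {j. k + 1 \<le> j} ^ w" by simp
    finally show ?thesis using power_mono[OF q(2,1)] by simp
  qed
  have "measure_pmf.prob ?M {f. \<forall>j\<in>{..<u}. \<not> ?R j f} = (\<Prod>j\<in>{..<u}. measure_pmf.prob ?M {f. \<not> ?R j f})"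
  proof (rule prob_Pi_pmf_disjoint_family[OF finite_verts_wheel])
    show "disjoint_family_on ?D {..<u}"
      using n(1) by (intro disjoint_blocks[of u]) (auto simp: algebra_simps)
    show "?D j \<subseteq> ?V" for j by (rule pos_image_subset_verts[OF n(2)])
    fix j and f g :: "nat option \<Rightarrow> bool" assume fg: "\<forall>v\<in>?D j. f v = g v"
    have "{v \<in> ?C j i. f v} = {v \<in> ?C j i. g v}" if "i < w" for i
    proof -
      have "int i * int (2 * k) + int (2 * k) \<le> int w * int (2 * k)" by (rule block_subset[OF that])
      then have "?C j i \<subseteq> ?D j" by (intro image_mono) (auto simp: algebra_simps)
      then show ?thesis using fg by blast
    qed
    then show "(\<not> ?R j f) = (\<not> ?R j g)" by simp
  qed simp
  also have "\<dots> \<le> (\<Prod>j\<in>{..<u}. 1 - q ^ w)"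
  proof (intro prod_mono conjI)
    fix j
    have "measure_pmf.prob ?M {f. \<not> ?R j f} = 1 - measure_pmf.prob ?M {f. ?R j f}"
      by (rule prob_pmf_not)
    then show "measure_pmf.prob ?M {f. \<not> ?R j f} \<le> 1 - q ^ w" using R[of j] by linarith
  qed simp
  finally show ?thesis by simp
qed

text \<open>A bad segment has a passive window, handled by a union bound over its starting points,
  or lacks a region of dense cells.\<close>

lemma prob_bad_segment_le:
  assumes n: "2 * k * w * u \<le> n" "n > 0" "w > 0" "u > 0" and r: "1 \<le> r" "r \<le> n" and p: "p \<in> {0..1}"
    and q: "0 \<le> q" "q \<le> measure_pmf.prob (binomial_pmf (2 * k) p) {j. k + 1 \<le> j}"
  shows "measure_pmf.prob (Pi_pmf (verts (wheel r n)) False (\<lambda>_. bernoulli_pmf p))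
      {f. \<not> good_segment n r k w u s f} \<le> real (2 * k * w * u) * (1 - p) ^ r + (1 - q ^ w) ^ u"
    (is "measure_pmf.prob ?M _ \<le> _")
proof -
  define M where "M = 2 * k * w * u"
  define Y where "Y = {s..s + int M - int r}"
  define E1 where "E1 = (\<Union>y\<in>Y. {f. \<forall>v\<in>pos n ` {y..<y + int r}. \<not> f v})"
  define E2 where "E2 = {f. \<forall>j\<in>{..<u}. \<not> (\<forall>i\<in>{..<w}. k + 1 \<le> card {v \<in> pos n ` {s + int j * int (2 * k * w) + int i * int (2 * k)
        ..<s + int j * int (2 * k * w) + int i * int (2 * k) + int (2 * k)}. f v})}"
  have "{f. \<not> good_segment n r k w u s f} \<subseteq> E1 \<union> E2"
  proof (intro subsetI, rule ccontr)
    fix f assume f: "f \<in> {f. \<not> good_segment n r k w u s f}" "f \<notin> E1 \<union> E2"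
    have "\<exists>v\<in>pos n ` {y..<y + int r}. f v" if "s \<le> y" "y + int r \<le> s + int M" for y
      using f(2) that by (force simp: E1_def Y_def)
    moreover have "\<exists>j<u. \<forall>i<w. k + 1 \<le> card {v \<in> pos n ` {s + int (2 * k * w) * int j + int (2 * k) * int i
        ..<s + int (2 * k * w) * int j + int (2 * k) * int i + int (2 * k)}. f v}"
      using f(2) unfolding E2_def mult.commute[of "int (2 * k * w)"] mult.commute[of "int (2 * k)"] by blast
    ultimately have "good_segment n r k w u s f"
      unfolding good_segment_def M_def by blast
    with f(1) show False by simp
  qed
  then have "measure_pmf.prob ?M {f. \<not> good_segment n r k w u s f} \<le> measure_pmf.prob ?M (E1 \<union> E2)"
    by (rule measure_pmf.finite_measure_mono) simp
  also have "\<dots> \<le> measure_pmf.prob ?M E1 + measure_pmf.prob ?M E2"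
    by (rule measure_Un_le) auto
  also have "measure_pmf.prob ?M E2 \<le> (1 - q ^ w) ^ u"
    unfolding E2_def by (rule prob_no_dense_region_le[OF n p q])
  also have "measure_pmf.prob ?M E1 \<le> real M * (1 - p) ^ r"
  proof -
    have "measure_pmf.prob ?M E1 \<le> (\<Sum>y\<in>Y. measure_pmf.prob ?M {f. \<forall>v\<in>pos n ` {y..<y + int r}. \<not> f v})"
      unfolding E1_def by (rule measure_pmf.finite_measure_subadditive_finite) (auto simp: Y_def)
    also have "\<dots> = (\<Sum>y\<in>Y. (1 - p) ^ r)"
      using prob_all_passive[OF finite_verts_wheel pos_image_subset_verts[OF n(2)] p]
      by (intro sum.cong refl) (simp only: card_block[OF r(2)])
    also have "\<dots> = real (card Y) * (1 - p) ^ r" by simp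
    also have "\<dots> \<le> real M * (1 - p) ^ r"
      using p r(1) by (intro mult_right_mono) (auto simp: Y_def)
    finally show ?thesis .
  qed
  finally show ?thesis unfolding M_def by simp
qed

text \<open>There are at most \<open>2^K\<close> sets \<open>S\<close> with more than
  \<open>K / 4\<close> indices. As \<open>256 = 4^4\<close>, each has all its events with
  probability at most \<open>(1/4)^(4 |S|) \<le> (1/4)^K\<close>.\<close>

lemma prob_more_than_quarter_le:
  assumes "finite V" "disjoint_family_on D {..<K}" "\<And>i. i < K \<Longrightarrow> D i \<subseteq> V"
    and E: "\<And>i f g. i < K \<Longrightarrow> (\<forall>v\<in>D i. f v = g v) \<Longrightarrow> E i f = E i g"
    and le: "\<And>i. i < K \<Longrightarrow> measure_pmf.prob (Pi_pmf V d P) {f. E i f} \<le> 1 / 256"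
  shows "measure_pmf.prob (Pi_pmf V d P) {f. K < 4 * card {i. i < K \<and> E i f}} \<le> (1 / 2) ^ K"
proof -
  let ?M = "Pi_pmf V d P"
  define T where "T = {S. S \<subseteq> {..<K} \<and> K < 4 * card S}"
  have fin: "finite T" unfolding T_def by (rule finite_subset[of _ "Pow {..<K}"]) auto
  have "card T \<le> card (Pow {..<K})" unfolding T_def by (intro card_mono) auto
  then have "real (card T) \<le> real (2 ^ K)"
    unfolding of_nat_le_iff by (simp add: card_Pow)
  then have cardT: "real (card T) \<le> 2 ^ K" by simp
  have "{f. K < 4 * card {i. i < K \<and> E i f}} \<subseteq> (\<Union>S\<in>T. {f. \<forall>i\<in>S. E i f})"
  proof
    fix f assume f: "f \<in> {f. K < 4 * card {i. i < K \<and> E i f}}"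
    have "{i. i < K \<and> E i f} \<in> T" using f by (auto simp: T_def)
    then show "f \<in> (\<Union>S\<in>T. {f. \<forall>i\<in>S. E i f})" by blast
  qed
  then have "measure_pmf.prob ?M {f. K < 4 * card {i. i < K \<and> E i f}} \<le>
      measure_pmf.prob ?M (\<Union>S\<in>T. {f. \<forall>i\<in>S. E i f})"
    by (rule measure_pmf.finite_measure_mono) simp
  also have "\<dots> \<le> (\<Sum>S\<in>T. measure_pmf.prob ?M {f. \<forall>i\<in>S. E i f})"
    by (rule measure_pmf.finite_measure_subadditive_finite[OF fin]) simp
  also have "\<dots> \<le> (\<Sum>S\<in>T. (1 / 4) ^ K)"
  proof (rule sum_mono)
    fix S assume "S \<in> T"
    then have S: "S \<subseteq> {..<K}" "K < 4 * card S" by (auto simp: T_def)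
    have "measure_pmf.prob ?M {f. \<forall>i\<in>S. E i f} = (\<Prod>i\<in>S. measure_pmf.prob ?M {f. E i f})"
    proof (rule prob_Pi_pmf_disjoint_family[OF assms(1)])
      show "finite S" using S(1) finite_subset by blast
      show "disjoint_family_on D S" using disjoint_family_on_mono[OF S(1) assms(2)] .
      show "D i \<subseteq> V" if "i \<in> S" for i using that S(1) by (intro assms(3)) auto
      show "E i f = E i g" if "i \<in> S" "\<forall>v\<in>D i. f v = g v" for i f g
        using that S(1) by (intro E) auto
    qed
    also have "\<dots> \<le> (\<Prod>i\<in>S. 1 / 256)"
      using S(1) le by (intro prod_mono) auto
    also have "\<dots> = (1 / 4) ^ (4 * card S)"
      by (simp add: power_mult power_divide)
    also have "\<dots> \<le> (1 / 4 :: real) ^ K"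
      using S(2) by (intro power_decreasing) auto
    finally show "measure_pmf.prob ?M {f. \<forall>i\<in>S. E i f} \<le> (1 / 4) ^ K" .
  qed
  also have "\<dots> = real (card T) * (1 / 4) ^ K" by simp
  also have "\<dots> \<le> 2 ^ K * (1 / 4) ^ K"
    using cardT by (rule mult_right_mono) simp
  also have "\<dots> = (1 / 2) ^ K"
    by (simp flip: power_mult_distrib)
  finally show ?thesis .
qed

text \<open>Up to an error \<open>(1/2)^K\<close>, at least three quarters of the \<open>K\<close>
  disjoint segments are good. From \<open>12 \<le> u\<close> follows \<open>24 r \<le> M\<close>, so
  the ends of length \<open>r\<close> cost at most a twelfth of each segment.\<close>

lemma percolation_prob_wheel_ge:
  assumes k: "3 \<le> k" and r: "(k + 1) * (8 * k + 1) + 2 * k \<le> r" and w: "r \<le> k * w" and u: "12 \<le> u"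
    and M: "M = 2 * k * w * u" and K: "K = n div M" "3 \<le> K" and p: "p \<in> {0..1}"
    and q: "0 \<le> q" "q \<le> measure_pmf.prob (binomial_pmf (2 * k) p) {j. k + 1 \<le> j}"
    and small: "real M * (1 - p) ^ r + (1 - q ^ w) ^ u \<le> 1 / 256"
  shows "1 - (1 / 2) ^ K \<le> percolation_prob (wheel r n) p"
proof -
  let ?P = "Pi_pmf (verts (wheel r n)) False (\<lambda>_. bernoulli_pmf p)"
  let ?bad = "\<lambda>i f. \<not> good_segment n r k w u (int i * int M) f"
  have r1: "1 \<le> r" using r k by linarith
  have "w \<noteq> 0" using w r1 by (intro notI) simp
  then have w0: "w > 0" by simp
  have "24 * r \<le> 2 * u * (k * w)"
    using w u by (intro mult_mono) auto
  then have M24: "24 * r \<le> M" by (simp add: M algebra_simps)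
  have M0: "M > 0" using M24 r1 by linarith
  have KM: "K * M \<le> n" by (simp add: K(1))
  have "n mod M < M" using M0 by simp
  then have nKM: "n + 1 \<le> K * M + M" using div_mult_mod_eq[of n M] unfolding K(1) by linarith
  have "3 * M \<le> K * M" using K(2) by (intro mult_right_mono) auto
  then have n: "M \<le> n" "2 * r < n" "n > 0" "r \<le> n" using KM M24 M0 by linarith+
  have "measure_pmf.prob ?P {f. K < 4 * card {i. i < K \<and> ?bad i f}} \<le> (1 / 2) ^ K"
  proof (rule prob_more_than_quarter_le[where D = "\<lambda>i. pos n ` {0 + int i * int M..<0 + int i * int M + int M}", OF finite_verts_wheel])
    show "disjoint_family_on (\<lambda>i. pos n ` {0 + int i * int M..<0 + int i * int M + int M}) {..<K}"
      by (rule disjoint_blocks[OF KM]) auto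
    show "pos n ` {0 + int i * int M..<0 + int i * int M + int M} \<subseteq> verts (wheel r n)" for i
      by (rule pos_image_subset_verts[OF n(3)])
    show "?bad i f = ?bad i g"
      if "\<forall>v\<in>pos n ` {0 + int i * int M..<0 + int i * int M + int M}. f v = g v" for i f g
      using good_segment_cong[of n "int i * int M" k w u f g r] that unfolding M add_0 by blast
    show "measure_pmf.prob ?P {f. ?bad i f} \<le> 1 / 256" for i
      using prob_bad_segment_le[OF n(1)[unfolded M] n(3) w0 _ r1 n(4) p q] u small unfolding M
      by (meson less_le_trans order_trans zero_less_numeral)
  qed
  moreover have "- {f. percolates (wheel r n) {v \<in> verts (wheel r n). f v}} \<subseteq>
      {f. K < 4 * card {i. i < K \<and> ?bad i f}}"
  proof (intro subsetI, rule ccontr)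
    fix f assume f: "f \<in> - {f. percolates (wheel r n) {v \<in> verts (wheel r n). f v}}"
      "f \<notin> {f. K < 4 * card {i. i < K \<and> ?bad i f}}"
    define G where "G = {i. i < K \<and> \<not> ?bad i f}"
    have "{i. i < K \<and> ?bad i f} = {..<K} - G" by (auto simp: G_def)
    moreover have "card ({..<K} - G) = K - card G"
      by (subst card_Diff_subset) (auto simp: G_def)
    moreover have "card G \<le> K"
      using card_mono[of "{..<K}" G] by (auto simp: G_def)
    ultimately have G: "3 * K \<le> 4 * card G" using f(2) by simp
    have "percolates (wheel r n) {v \<in> verts (wheel r n). f v}"
    proof (rule percolates_if_many_good[OF n(2) k r w M KM, of G])
      \<comment> \<open>Twice the active count is at least
        \<open>2 * (3/4) * (11/12) * K M = (11/8) K M\<close>. With \<open>3 \<le> K\<close> the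
        excess \<open>(3/8) K M\<close> covers the fewer than \<open>M\<close> vertices outside the
        segments.\<close>
      have "33 * (K * M) = (3 * K) * (11 * M)" by simp
      also have "\<dots> \<le> (4 * card G) * (12 * (M - 2 * r))"
        by (rule mult_le_mono) (use G M24 in linarith)+
      finally have "33 * (K * M) \<le> 24 * (2 * (card G * (M - 2 * r)))" by simp
      moreover have "9 * (K * M) \<ge> 24 * M" using \<open>3 * M \<le> K * M\<close> by linarith
      ultimately show "n + 1 \<le> 2 * (card G * (M - 2 * r))" using nKM by linarith
    qed (auto simp: G_def)
    with f(1) show False by simp
  qed
  then have "measure_pmf.prob ?P (- {f. percolates (wheel r n) {v \<in> verts (wheel r n). f v}}) \<le>
      measure_pmf.prob ?P {f. K < 4 * card {i. i < K \<and> ?bad i f}}"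
    by (rule measure_pmf.finite_measure_mono) simp
  moreover have "measure_pmf.prob ?P (- {f. percolates (wheel r n) {v \<in> verts (wheel r n). f v}}) =
      1 - percolation_prob (wheel r n) p"
    unfolding percolation_prob_def Collect_neg_eq[symmetric] by (rule prob_pmf_not)
  ultimately show ?thesis by linarith
qed

section \<open>Probability of a dense cell and choice of the parameters\<close>

lemma Suc_times_choose_Suc_half: "Suc k * ((2 * k) choose Suc k) = k * ((2 * k) choose k)"
proof -
  have "Suc k * ((2 * k) choose Suc k) = (2 * k - k) * ((2 * k) choose k)"
    unfolding binomial_absorption binomial_absorb_comp ..
  moreover have "2 * k - k = k" by simp
  ultimately show ?thesis by (simp only:)
qed

text \<open>Only the term \<open>k + 1\<close> of the tail is kept. Its coefficient is
  \<open>k / (k + 1) \<ge> 1 / 2\<close> times the central one, which is at least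
  \<open>4^k / (2 k)\<close>.\<close>

lemma binomial_cell_ge:
  assumes "1 \<le> k" and p: "p \<in> {0..1}"
  shows "(4 * p) ^ k * (1 - p) ^ k * p / (4 * real k) \<le> measure_pmf.prob (binomial_pmf (2 * k) p) {j. k + 1 \<le> j}"
proof -
  have "4 ^ k / (2 * real k) \<le> real ((2 * k) choose k)"
    using central_binomial_lower_bound[of k] assms(1) by simp
  also have "\<dots> \<le> 2 * real ((2 * k) choose Suc k)"
  proof -
    have "k * ((2 * k) choose k) \<le> k * (2 * ((2 * k) choose Suc k))"
      using assms(1) unfolding Suc_times_choose_Suc_half[symmetric] by (simp add: algebra_simps)
    then have "(2 * k) choose k \<le> 2 * ((2 * k) choose Suc k)" using assms(1) by simp
    then have "real ((2 * k) choose k) \<le> real (2 * ((2 * k) choose Suc k))" by (simp only: of_nat_le_iff)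
    then show ?thesis by simp
  qed
  finally have c: "4 ^ k / (4 * real k) \<le> real ((2 * k) choose Suc k)" by simp
  have "(4 * p) ^ k * (1 - p) ^ k * p / (4 * real k) = 4 ^ k / (4 * real k) * p ^ Suc k * (1 - p) ^ k"
    by (simp add: power_mult_distrib)
  also have "\<dots> \<le> real ((2 * k) choose Suc k) * p ^ Suc k * (1 - p) ^ (2 * k - Suc k)"
    using p by (intro mult_mono c order_refl power_decreasing) auto
  also have "\<dots> = pmf (binomial_pmf (2 * k) p) (k + 1)"
    using p by simp
  also have "\<dots> = measure_pmf.prob (binomial_pmf (2 * k) p) {k + 1}"
    by (simp add: measure_pmf_single)
  also have "\<dots> \<le> measure_pmf.prob (binomial_pmf (2 * k) p) {j. k + 1 \<le> j}"
    by (rule measure_pmf.finite_measure_mono) auto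
  finally show ?thesis .
qed

text \<open>
  This is where \<open>p > 1/4\<close> enters: \<open>(4 p)^k\<close> beats the polynomial factor. The factor \<open>2\<close> per cell
  accumulates to \<open>2^w\<close> in the comparison of births with blocking runs.
\<close>

lemma ex_cell_size:
  fixes p :: real
  assumes "1 / 4 < p" "p < 1"
  shows "\<exists>k\<ge>3. 2 * (1 - p) ^ k \<le> measure_pmf.prob (binomial_pmf (2 * k) p) {j. k + 1 \<le> j}"
proof -
  have "(\<lambda>k. real k * (1 / (4 * p)) ^ k) \<longlonglongrightarrow> 0"
    using assms by (intro powser_times_n_limit_0) simp
  \<comment> \<open>The bound \<open>p / 8\<close> is what rearranges to
    \<open>2 \<le> (4 * p) ^ k * p / (4 * real k)\<close>.\<close>
  then have "\<forall>\<^sub>F k in sequentially. real k * (1 / (4 * p)) ^ k < p / 8"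
    using assms by (intro order_tendstoD) auto
  then have "\<forall>\<^sub>F k in sequentially. real k * (1 / (4 * p)) ^ k < p / 8 \<and> 3 \<le> k"
    by (intro eventually_conj eventually_ge_at_top)
  then obtain k where k: "real k * (1 / (4 * p)) ^ k < p / 8" "3 \<le> k"
    by (metis (no_types, lifting) eventually_sequentially order_refl)
  have "real k < p / 8 * (4 * p) ^ k"
    using k(1) assms by (simp add: power_divide divide_less_eq)
  then have "2 \<le> (4 * p) ^ k * p / (4 * real k)"
    using k(2) by (simp add: field_simps)
  then have "2 * (1 - p) ^ k \<le> (4 * p) ^ k * p / (4 * real k) * (1 - p) ^ k"
    using assms by (intro mult_right_mono) auto
  also have "\<dots> = (4 * p) ^ k * (1 - p) ^ k * p / (4 * real k)" by simp
  also have "\<dots> \<le> measure_pmf.prob (binomial_pmf (2 * k) p) {j. k + 1 \<le> j}"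
    using k(2) assms by (intro binomial_cell_ge) auto
  finally show ?thesis using k(2) by blast
qed

lemma filterlim_div_const:
  assumes "M > 0"
  shows "filterlim (\<lambda>n. n div M) sequentially (sequentially :: nat filter)"
  unfolding filterlim_at_top
proof
  fix Z :: nat
  have "Z \<le> n div M" if "Z * M \<le> n" for n
    using that assms by (simp add: less_eq_div_iff_mult_less_eq)
  then show "\<forall>\<^sub>F n in sequentially. Z \<le> n div M"
    unfolding eventually_sequentially by blast
qed

text \<open>\<open>k\<close> depends on \<open>p\<close> only, then \<open>w\<close> and
  \<open>u\<close> are chosen for each large \<open>r\<close>. Order \<open>1 / q^w\<close> regions
  make a birth likely, and over such a segment the expected number of passive windows is still at
  most \<open>c * w * (1/2)^w\<close>.\<close>

lemma percolation_prob_wheel_tendsto_1: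
  fixes p :: real
  assumes p: "1 / 4 < p" "p < 1"
  shows "\<forall>\<^sub>F r in sequentially. (\<lambda>n. percolation_prob (wheel r n) p) \<longlonglongrightarrow> 1"
proof -
  obtain k where k: "3 \<le> k" and cell: "2 * (1 - p) ^ k \<le> measure_pmf.prob (binomial_pmf (2 * k) p) {j. k + 1 \<le> j}"
    using ex_cell_size[OF p] by blast
  define q where "q = 2 * (1 - p) ^ k"
  define c where "c = 26 * real k / (1 - p) ^ k"
  have p': "p \<in> {0..1}" using p by simp
  have q0: "0 < q" using p by (simp add: q_def)
  have q1: "q \<le> 1"
    using cell measure_pmf.prob_le_1[of "binomial_pmf (2 * k) p" "{j. k + 1 \<le> j}"] unfolding q_def by linarith
  have "(\<lambda>w. c * (real w * (1 / 2) ^ w)) \<longlonglongrightarrow> c * 0"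
    by (intro tendsto_mult tendsto_const powser_times_n_limit_0) simp
  then have "\<forall>\<^sub>F w in sequentially. c * (real w * (1 / 2) ^ w) < 1 / 512"
    by (rule order_tendstoD) simp
  then obtain w0 where w0: "\<And>w. w0 \<le> w \<Longrightarrow> c * (real w * (1 / 2) ^ w) < 1 / 512"
    unfolding eventually_sequentially by blast
  have "(\<lambda>n. percolation_prob (wheel r n) p) \<longlonglongrightarrow> 1"
    if r: "(k + 1) * (8 * k + 1) + 2 * k \<le> r" "k * w0 \<le> r" for r
  proof -
    \<comment> \<open>This gives \<open>r \<le> k * w \<le> r + k\<close>: long enough for
      nucleation, with an overshoot that costs only the factor \<open>1 / (1 - p) ^ k\<close>
      contained in \<open>c\<close>.\<close>
    define w where "w = r div k + 1"
    define u where "u = nat \<lceil>12 / q ^ w\<rceil>"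
    define M where "M = 2 * k * w * u"
    have rdiv: "k * (r div k) \<le> r" "r < k * (r div k) + k"
      using k mod_less_divisor[of k r] mult_div_mod_eq[of k r] by linarith+
    then have w: "r \<le> k * w" "k * w \<le> r + k" by (simp_all add: w_def)
    have "k * w0 \<le> k * w" using r(2) w(1) by linarith
    then have "w0 \<le> w" using k by simp
    have qw: "0 < q ^ w" "q ^ w \<le> 1" using q0 q1 by (auto intro: power_le_one)
    then have inv: "1 \<le> 1 / q ^ w" by simp
    have u: "12 / q ^ w \<le> real u" "real u \<le> 13 / q ^ w"
    proof -
      show "12 / q ^ w \<le> real u" using qw by (simp add: u_def of_nat_ceiling)
      have "real u \<le> 12 / q ^ w + 1" using qw by (simp add: u_def of_nat_ceiling)
      also have "\<dots> \<le> 12 / q ^ w + 1 / q ^ w" using inv by simp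
      also have "\<dots> = 13 / q ^ w" by (simp flip: add_divide_distrib)
      finally show "real u \<le> 13 / q ^ w" .
    qed
    have "12 \<le> 12 / q ^ w" using inv mult_left_mono[OF inv, of 12] by simp
    then have u12: "12 \<le> u" using u(1) by linarith
    have "w > 0" by (simp add: w_def)
    then have M0: "M > 0" using k u12 by (simp add: M_def)
    have t1: "real M * (1 - p) ^ r \<le> 1 / 512"
    proof -
      have "real M * (1 - p) ^ r = 2 * real k * real w * (1 - p) ^ r * real u" by (simp add: M_def)
      also have "\<dots> \<le> 2 * real k * real w * (1 - p) ^ r * (13 / q ^ w)"
        using u(2) p by (intro mult_left_mono) auto
      \<comment> \<open>\<open>q ^ w = 2 ^ w * (1 - p) ^ (k * w)\<close>: the factor 2 gained per
        cell is the source of the decay.\<close>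
      also have "\<dots> = 26 * real k * real w * (1 / 2) ^ w * ((1 - p) ^ r / (1 - p) ^ (k * w))"
        by (simp add: q_def power_mult_distrib power_mult power_divide)
      also have "\<dots> \<le> 26 * real k * real w * (1 / 2) ^ w * (1 / (1 - p) ^ k)"
      proof (rule mult_left_mono)
        have "(1 - p) ^ r * (1 - p) ^ k \<le> (1 - p) ^ (k * w)"
          using w(2) p by (simp flip: power_add add: power_decreasing)
        then show "(1 - p) ^ r / (1 - p) ^ (k * w) \<le> 1 / (1 - p) ^ k"
          using p by (simp add: field_simps)
      qed simp
      also have "\<dots> = c * (real w * (1 / 2) ^ w)" by (simp add: c_def)
      also have "\<dots> \<le> 1 / 512" using w0[OF \<open>w0 \<le> w\<close>] by simp
      finally show ?thesis .
    qed
    have t2: "(1 - q ^ w) ^ u \<le> 1 / 512"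
    proof -
      have "(1 - q ^ w) ^ u \<le> exp (- (real u * q ^ w))"
        using qw by (intro power_one_minus_le_exp) auto
      also have "\<dots> \<le> exp (- 12)" using u(1) qw(1) by (simp add: pos_divide_le_eq)
      also have "\<dots> = exp (- 6) * exp (- 6 :: real)" by (simp flip: exp_add)
      also have "\<dots> \<le> (1 / 64) * (1 / 64)"
        using exp_minus_6_le by (intro mult_mono) auto
      finally show ?thesis by simp
    qed
    have lower: "1 - (1 / 2) ^ (n div M) \<le> percolation_prob (wheel r n) p" if "3 * M \<le> n" for n
    proof (rule percolation_prob_wheel_ge[OF k r(1) w(1) u12 M_def refl _ p', of n q])
      show "3 \<le> n div M" using that M0 by (simp add: less_eq_div_iff_mult_less_eq)
      show "real M * (1 - p) ^ r + (1 - q ^ w) ^ u \<le> 1 / 256" using t1 t2 by linarith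
    qed (use q0 cell in \<open>simp_all add: q_def\<close>)
    show ?thesis
    proof (rule tendsto_sandwich)
      show "\<forall>\<^sub>F n in sequentially. 1 - (1 / 2) ^ (n div M) \<le> percolation_prob (wheel r n) p"
        using lower unfolding eventually_sequentially by blast
      show "\<forall>\<^sub>F n in sequentially. percolation_prob (wheel r n) p \<le> 1"
        by (simp add: percolation_prob_def)
      have "(\<lambda>n. (1 / 2 :: real) ^ (n div M)) \<longlonglongrightarrow> 0"
        using filterlim_compose[OF LIMSEQ_power_zero filterlim_div_const[OF M0], of "1 / 2 :: real"] by simp
      from tendsto_diff[OF tendsto_const this, of 1]
      show "(\<lambda>n. 1 - (1 / 2 :: real) ^ (n div M)) \<longlonglongrightarrow> 1" by simp
    qed simp
  qed
  then show ?thesis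
    unfolding eventually_sequentially
    by (intro exI[of _ "max ((k + 1) * (8 * k + 1) + 2 * k) (k * w0)"]) simp
qed

section \<open>Limit of the critical probability\<close>

lemma eventually_liminf_percolation_prob_eq_1:
  fixes p :: real
  assumes "1 / 4 < p" "p < 1"
  shows "\<forall>\<^sub>F r in sequentially. p \<in> {p \<in> {0..1}. liminf (\<lambda>n. ereal (percolation_prob (wheel r n) p)) = 1}"
  using percolation_prob_wheel_tendsto_1[OF assms]
proof eventually_elim
  case (elim r)
  then have "(\<lambda>n. ereal (percolation_prob (wheel r n) p)) \<longlonglongrightarrow> ereal 1"
    by (rule tendsto_ereal)
  then have "liminf (\<lambda>n. ereal (percolation_prob (wheel r n) p)) = ereal 1"
    by (intro lim_imp_Liminf) simp_all
  then show ?case using assms by (simp add: one_ereal_def)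
qed

theorem theorem1:
  shows "(\<lambda>r. critical_prob (wheel r)) \<longlonglongrightarrow> 1 / 4"
proof (rule order_tendstoI)
  let ?S = "\<lambda>r. {p \<in> {0..1}. liminf (\<lambda>n. ereal (percolation_prob (wheel r n) p)) = 1}"
  fix a :: real assume a: "a < 1 / 4"
  \<comment> \<open>\<open>1 / 4 - e\<close> is at least the midpoint of \<open>a\<close> and
    \<open>1 / 4\<close>; the cap \<open>1 / 8\<close> keeps \<open>e\<close> below
    \<open>1 / 4\<close> when \<open>a\<close> is negative.\<close>
  define e where "e = min (1 / 8) (1 / 8 - a / 2)"
  have "0 < e" using a by (simp add: e_def)
  moreover have "e \<le> 1 / 8" unfolding e_def by (rule min.cobounded1)
  moreover have "e \<le> 1 / 8 - a / 2" unfolding e_def by (rule min.cobounded2)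
  ultimately have e: "0 < e" "e < 1 / 4" "a < 1 / 4 - e" using a by simp_all
  \<comment> \<open>The point \<open>1 / 2\<close> serves to make the set nonempty, as a lower bound
    on its infimum requires.\<close>
  have "\<forall>\<^sub>F r in sequentially. 1 / 2 \<in> ?S r"
    by (rule eventually_liminf_percolation_prob_eq_1) simp_all
  then show "\<forall>\<^sub>F r in sequentially. a < critical_prob (wheel r)"
    using eventually_succ_mult_power_le[OF e(1,2)]
  proof eventually_elim
    case (elim r)
    have "1 / 4 - e \<le> Inf (?S r)"
    proof (rule cInf_greatest)
      show "?S r \<noteq> {}" using elim(1) by blast
      fix p assume "p \<in> ?S r"
      \<comment> \<open>The smallness condition involves only \<open>r\<close> and \<open>e\<close>,
        so one \<open>r\<close> excludes every \<open>p \<le> 1 / 4 - e\<close> at once.\<close>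
      then show "1 / 4 - e \<le> p"
        using liminf_percolation_prob_wheel_neq_1[of p e r] e(1) elim(2) by force
    qed
    then show ?case using e(3) by (simp add: critical_prob_def)
  qed
next
  let ?S = "\<lambda>r. {p \<in> {0..1}. liminf (\<lambda>n. ereal (percolation_prob (wheel r n) p)) = 1}"
  fix a :: real assume a: "1 / 4 < a"
  define p where "p = min (1 / 2) ((1 / 4 + a) / 2)"
  have p: "1 / 4 < p" "p < 1" "p < a" using a by (auto simp: p_def min_def)
  from eventually_liminf_percolation_prob_eq_1[OF p(1,2)]
  show "\<forall>\<^sub>F r in sequentially. critical_prob (wheel r) < a"
  proof eventually_elim
    case (elim r)
    have "Inf (?S r) \<le> p"
      using elim by (rule cInf_lower) (auto intro: bdd_belowI[of _ 0])
    then show ?case using p(3) by (simp add: critical_prob_def)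
  qed
qed

end
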